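(* Let $m\ge1$, and let $\tilde z$ be an $m$-closed integrable cross-ratio map (in rotated coordinates, with edge-labels $\alpha,\beta$) such that $\tilde z_{i,0}=0$ for all $i\in2\mathbb Z$. Assume that the propagation map $T$ can be applied to $(\tilde z_0,\tilde z_1)$ at least $2m-2$ times. Then for all $i\in2\mathbb Z+1$, $$\tilde z_{i,2m-1}=\frac{\sum_{\ell=0}^{m-1}(\alpha_\ell-\beta_\ell)}{\sum_{\ell=0}^{m-1}\frac{1}{\tilde z_{2\ell+1,1}}(\alpha_\ell-\beta_{-\ell-1})}=\frac{1}{M[z^*]}\sum_{\ell=0}^{m-1}(\alpha_\ell-\beta_\ell),$$ where $M[z^*]$ is the additive monodromy of a dual map $z^*$ of $z$.
   Context: $\hat{\mathbb C}=\mathbb C\cup\{\infty\}$ is identified with $\mathbb{CP}^1$; $\operatorname{cr}(a,b,c,d)=\frac{(a-b)(c-d)}{(b-c)(d-a)}$. Given edge-labels $\alpha,\beta:\mathbb Z\to\mathbb C\setminus\{0\}$, an integrable cross-ratio map is a map $z:\mathbb Z^2\to\hat{\mathbb C}$ with $\operatorname{cr}(z_{i,j},z_{i+1,j},z_{i+1,j+1},z_{i,j+1})=\alpha_i/\beta_j$ for all $(i,j)\in\mathbb Z^2$. Rotated coordinates: $z_{i,j}=\tilde z_{i-j,i+j}$, so $\tilde z_{i,j}$ is defined for $i+j$ even, and $\tilde z_j=(\tilde z_{i,j})_{i\equiv j \bmod 2}$. The cross-ratio relation together with $\alpha,\beta$ determines $\tilde z_{j+2}$ from $(\tilde z_j,\tilde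 z_{j+1})$; the propagation map is $T:(\tilde z_j,\tilde z_{j+1})\mapsto(\tilde z_{j+1},\tilde z_{j+2})$. The map $z$ is $m$-closed if $\alpha_{i+m}=\alpha_i$, $\beta_{i+m}=\beta_i$ and $z_{i+m,j-m}=z_{i,j}$ for all $i,j$ (the last condition is equivalent to $\tilde z_{i+2m,j}=\tilde z_{i,j}$ for all $i+j$ even). When $\tilde z_0$ is constant, backward propagation is undefined, and $z$ is understood as obtained from $(\tilde z_0,\tilde z_1)$ by forward propagation. Dual map: $z^*$ is obtained by integrating the closed discrete 1-form $\mathrm dz^*((i,j),(i+1,j))=\frac{\alpha_i}{z_{i,j}-z_{i+1,j}}$, $\mathrm dz^*((i,j),(i,j+1))=\frac{\beta_j}{z_{i,j}-z_{i,j+1}}$; its additive monodromy is $M[z^*]=z^*_{i+m,j-m}-z^*_{i,j}$, which does not depend on $(i,j)$ or on the choice of $z^*$. Standing assumption: the data are as generic as possible given the initial singularity; the equality may be seen as one of rational functions in the formal variables $\alpha,\beta,\tilde z_1$. *)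

theory Defs
  imports Complex_Main
begin

section \<open>The Riemann sphere and the cross-ratio\<close>

datatype rsphere = Fin complex | Infty

text \<open>Homogeneous coordinates, identifying the sphere with the complex projective line.\<close>

fun hom_coord :: "rsphere \<Rightarrow> complex \<times> complex" where
  "hom_coord (Fin a) = (a, 1)"
| "hom_coord Infty = (1, 0)"

definition bracket :: "rsphere \<Rightarrow> rsphere \<Rightarrow> complex" where
  "bracket p q = fst (hom_coord p) * snd (hom_coord q) - fst (hom_coord q) * snd (hom_coord p)"

text \<open>Every argument of the cross-ratio occurs once in the numerator and once in the denominator,
  so the value does not depend on the choice of homogeneous coordinates. Because
  \<open>x / 0 = 0\<close>, an equation \<open>cr a b c d = q\<close> with \<open>q \<noteq> 0\<close> forces all four brackets to be
  nonzero, that is, cyclically consecutive points are distinct and the cross-ratio is a genuine one.\<close>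

definition cr :: "rsphere \<Rightarrow> rsphere \<Rightarrow> rsphere \<Rightarrow> rsphere \<Rightarrow> complex" where
  "cr a b c d = (bracket a b * bracket c d) / (bracket b c * bracket d a)"

lemma cr_Fin:
  "cr (Fin a) (Fin b) (Fin c) (Fin d) = ((a - b) * (c - d)) / ((b - c) * (d - a))"
  by (simp add: cr_def bracket_def)

text \<open>The quotient of two complex numbers as a point of the sphere; it is meaningful unless both
  numbers are zero.\<close>

definition quot :: "complex \<Rightarrow> complex \<Rightarrow> rsphere" where
  "quot a b = (if b = 0 then Infty else Fin (a / b))"

text \<open>The reciprocal \<open>1 / p\<close> of a point \<open>p \<noteq> 0\<close> and the inverse difference \<open>1 / (p - q)\<close> of
  distinct points \<open>p, q\<close>, with \<open>1 / \<infinity> = 0\<close>.\<close>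

fun recip :: "rsphere \<Rightarrow> complex" where
  "recip (Fin a) = 1 / a"
| "recip Infty = 0"

fun inv_diff :: "rsphere \<Rightarrow> rsphere \<Rightarrow> complex" where
  "inv_diff (Fin a) (Fin b) = 1 / (a - b)"
| "inv_diff _ _ = 0"


section \<open>Integrable cross-ratio maps obtained by forward propagation\<close>

text \<open>The level of a vertex \<open>(i, j)\<close> is \<open>i + j\<close>. Propagating \<open>n\<close> times from levels 0 and 1
  gives the levels \<open>0, \<dots>, n + 1\<close>, and only these are constrained: below level 0 the map is not
  defined when level 0 is constant. Values of \<open>z\<close> at other vertices are irrelevant.\<close>

definition on_levels :: "nat \<Rightarrow> int \<Rightarrow> int \<Rightarrow> bool" where
  "on_levels n i j \<longleftrightarrow> 0 \<le> i + j \<and> i + j \<le> int n + 1"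

definition integrable_cr_map ::
    "nat \<Rightarrow> (int \<Rightarrow> complex) \<Rightarrow> (int \<Rightarrow> complex) \<Rightarrow> (int \<Rightarrow> int \<Rightarrow> rsphere) \<Rightarrow> bool" where
  "integrable_cr_map n \<alpha> \<beta> z \<longleftrightarrow>
     (\<forall>i. \<alpha> i \<noteq> 0 \<and> \<beta> i \<noteq> 0) \<and>
     (\<forall>i j. on_levels n i j \<and> on_levels n (i + 1) (j + 1) \<longrightarrow>
        cr (z i j) (z (i + 1) j) (z (i + 1) (j + 1)) (z i (j + 1)) = \<alpha> i / \<beta> j)"

definition m_closed ::
    "nat \<Rightarrow> nat \<Rightarrow> (int \<Rightarrow> complex) \<Rightarrow> (int \<Rightarrow> complex) \<Rightarrow> (int \<Rightarrow> int \<Rightarrow> rsphere) \<Rightarrow> bool" where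
  "m_closed n m \<alpha> \<beta> z \<longleftrightarrow>
     (\<forall>i. \<alpha> (i + int m) = \<alpha> i \<and> \<beta> (i + int m) = \<beta> i) \<and>
     (\<forall>i j. on_levels n i j \<longrightarrow> z (i + int m) (j - int m) = z i j)"

text \<open>Rotated coordinates: \<open>z i j = rot z (i - j) (i + j)\<close>. Only values at indices with even sum
  are meaningful.\<close>

definition rot :: "(int \<Rightarrow> int \<Rightarrow> 'a) \<Rightarrow> int \<Rightarrow> int \<Rightarrow> 'a" where
  "rot z i j = z ((i + j) div 2) ((j - i) div 2)"

lemma rot_coords: "rot z (i - j) (i + j) = z i j"
  by (simp add: rot_def)

text \<open>Domain of the propagation map at levels \<open>j, j + 1\<close>: for rows \<open>x\<close> (level \<open>j\<close>) and \<open>y\<close>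
  (level \<open>j + 1\<close>), the cross-ratio relation determines every point of level \<open>j + 2\<close>.\<close>

definition propagation_applicable ::
    "(int \<Rightarrow> complex) \<Rightarrow> (int \<Rightarrow> complex) \<Rightarrow> int \<Rightarrow> (int \<Rightarrow> rsphere) \<Rightarrow> (int \<Rightarrow> rsphere) \<Rightarrow> bool" where
  "propagation_applicable \<alpha> \<beta> j x y \<longleftrightarrow>
     (\<forall>i. even (i + j) \<longrightarrow>
        (\<exists>!c. cr (x i) (y (i + 1)) c (y (i - 1)) = \<alpha> ((i + j) div 2) / \<beta> ((j - i) div 2)))"

text \<open>The propagation map can be applied \<open>n\<close> times to the rows of level 0 and 1. For an
  integrable cross-ratio map, the uniqueness makes the row of level \<open>k + 2\<close> the one produced from
  the rows of level \<open>k\<close> and \<open>k + 1\<close>.\<close>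

definition propagates ::
    "nat \<Rightarrow> (int \<Rightarrow> complex) \<Rightarrow> (int \<Rightarrow> complex) \<Rightarrow> (int \<Rightarrow> int \<Rightarrow> rsphere) \<Rightarrow> bool" where
  "propagates n \<alpha> \<beta> z \<longleftrightarrow>
     (\<forall>k<n. propagation_applicable \<alpha> \<beta> (int k)
        (\<lambda>i. rot z i (int k)) (\<lambda>i. rot z i (int k + 1)))"


section \<open>Dual maps\<close>

text \<open>Differences along an oriented edge \<open>(v, w)\<close> are taken as \<open>f v - f w\<close>, on the dual side as in
  the denominators \<open>z\<^sub>v - z\<^sub>w\<close> of the form; with \<open>f w - f v\<close> on the dual side the monodromy would
  change its sign.\<close>

definition dual_map ::
    "nat \<Rightarrow> (int \<Rightarrow> complex) \<Rightarrow> (int \<Rightarrow> complex) \<Rightarrow> (int \<Rightarrow> int \<Rightarrow> rsphere)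
      \<Rightarrow> (int \<Rightarrow> int \<Rightarrow> complex) \<Rightarrow> bool" where
  "dual_map n \<alpha> \<beta> z zs \<longleftrightarrow>
     (\<forall>i j. on_levels n i j \<and> on_levels n (i + 1) j \<longrightarrow>
        zs i j - zs (i + 1) j = \<alpha> i * inv_diff (z i j) (z (i + 1) j)) \<and>
     (\<forall>i j. on_levels n i j \<and> on_levels n i (j + 1) \<longrightarrow>
        zs i j - zs i (j + 1) = \<beta> j * inv_diff (z i j) (z i (j + 1)))"

definition additive_monodromy :: "nat \<Rightarrow> (int \<Rightarrow> int \<Rightarrow> complex) \<Rightarrow> int \<Rightarrow> int \<Rightarrow> complex" where
  "additive_monodromy m zs i j = zs (i + int m) (j - int m) - zs i j"

text \<open>Dual maps exist because the form is closed.\<close>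

lemma dual_form_closed:
  assumes "cr a b c d = p / q" "p \<noteq> 0" "q \<noteq> 0"
  shows "p * inv_diff a b + q * inv_diff b c = q * inv_diff a d + p * inv_diff d c"
proof -
  have nz: "bracket a b \<noteq> 0" "bracket c d \<noteq> 0" "bracket b c \<noteq> 0" "bracket d a \<noteq> 0"
    using assms by (auto simp: cr_def)
  have eq: "q * (bracket a b * bracket c d) = p * (bracket b c * bracket d a)"
    using assms nz by (simp add: cr_def field_simps)
  have iv: "inv_diff x y = snd (hom_coord x) * snd (hom_coord y) / bracket x y" for x y
    by (cases x; cases y) (simp_all add: bracket_def)
  have sw: "bracket a d = - bracket d a" "bracket d c = - bracket c d"
    by (simp_all add: bracket_def)
  define A B C D where "A = snd (hom_coord a)" "B = snd (hom_coord b)"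
    "C = snd (hom_coord c)" "D = snd (hom_coord d)"
  define X where "X = A * B * bracket c d + C * D * bracket a b"
  have X: "X = - (B * C * bracket d a + A * D * bracket b c)"
    unfolding X_def A_B_C_D_def bracket_def by (simp add: algebra_simps)
  have "p * inv_diff a b - p * inv_diff d c = p * X / (bracket a b * bracket c d)"
    using nz by (simp add: iv sw X_def A_B_C_D_def field_simps)
  also have "\<dots> = q * X / (bracket b c * bracket d a)"
    using nz eq by (simp add: frac_eq_eq)
  also have "\<dots> = q * inv_diff a d - q * inv_diff b c"
    unfolding X using nz by (simp add: iv sw A_B_C_D_def field_simps)
  finally show ?thesis by (simp add: algebra_simps)
qed

lemma discrete_primitive:
  fixes d :: "int \<Rightarrow> complex"
  obtains g where "\<And>i. g (i + 1) = g i + d i"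
proof
  define g where "g i = (\<Sum>t\<in>{0..<i}. d t) - (\<Sum>t\<in>{i..<0}. d t)" for i
  fix i :: int
  show "g (i + 1) = g i + d i"
  proof (cases "0 \<le> i")
    case True
    then have "{0..<i + 1} = insert i {0..<i}" by auto
    with True show ?thesis by (simp add: g_def)
  next
    case False
    then have "{i..<0} = insert i {i + 1..<0}" by auto
    with False show ?thesis by (simp add: g_def)
  qed
qed

lemma dual_map_exists:
  assumes "integrable_cr_map n \<alpha> \<beta> z"
  shows "\<exists>zs. dual_map n \<alpha> \<beta> z zs"
proof -
  define e1 where "e1 i j = \<alpha> i * inv_diff (z i j) (z (i + 1) j)" for i j
  define e2 where "e2 i j = \<beta> j * inv_diff (z i j) (z i (j + 1))" for i j
  have closed: "e1 i j + e2 (i + 1) j = e2 i j + e1 i (j + 1)" if "0 \<le> i + j" "i + j < int n" for i j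
    using assms that unfolding e1_def e2_def integrable_cr_map_def on_levels_def
    by (intro dual_form_closed) auto
  obtain g where g: "\<And>i. g (i + 1) = g i + (e2 (i + 1) (- i - 1) - e1 i (- i))"
    using discrete_primitive[of "\<lambda>i. e2 (i + 1) (- i - 1) - e1 i (- i)"] by blast
  define F where
    "F = rec_nat g (\<lambda>k f i. f (i - 1) - e1 (i - 1) (int k - i + 1))"
  have F0: "F 0 = g" and FS: "F (Suc k) i = F k (i - 1) - e1 (i - 1) (int k - i + 1)" for k i
    by (simp_all add: F_def)
  have F2: "F (Suc k) i = F k i - e2 i (int k - i)" if "k \<le> n" for k i
    using that
  proof (induction k arbitrary: i)
    case 0
    show ?case using g[of "i - 1"] by (simp add: FS F0)
  next
    case (Suc k)
    have "e1 (i - 1) (int k - i + 1) + e2 i (int k - i + 1)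
        = e2 (i - 1) (int k - i + 1) + e1 (i - 1) (int k - i + 2)"
      using closed[of "i - 1" "int k - i + 1"] Suc.prems by (simp add: add.commute)
    moreover have "F (Suc k) (i - 1) = F k (i - 1) - e2 (i - 1) (int k - i + 1)"
      using Suc.IH[of "i - 1"] Suc.prems by (simp add: algebra_simps)
    moreover have "F (Suc (Suc k)) i = F (Suc k) (i - 1) - e1 (i - 1) (int k - i + 2)"
      using FS[of "Suc k" i] by (simp add: algebra_simps)
    ultimately have "F (Suc (Suc k)) i
        = F k (i - 1) - (e1 (i - 1) (int k - i + 1) + e2 i (int k - i + 1))"
      by simp
    then have "F (Suc (Suc k)) i = F (Suc k) i - e2 i (int k - i + 1)"
      by (simp add: FS[of k i])
    then show ?case by (simp add: algebra_simps)
  qed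
  define zs where "zs i j = F (nat (i + j)) i" for i j
  have lv: "nat (i + 1 + j) = Suc (nat (i + j))" "nat (i + (j + 1)) = Suc (nat (i + j))"
      "int (nat (i + j)) = i + j" if "0 \<le> i + j" for i j :: int
    using that by linarith+
  have "zs i j - zs (i + 1) j = e1 i j" if "0 \<le> i + j" for i j
    using FS[of "nat (i + j)" "i + 1"] lv[OF that] by (simp add: zs_def)
  moreover have "zs i j - zs i (j + 1) = e2 i j" if "0 \<le> i + j" "i + j \<le> int n" for i j
    using F2[of "nat (i + j)" i] lv[OF that(1)] that by (simp add: zs_def)
  ultimately have "dual_map n \<alpha> \<beta> z zs"
    by (auto simp: dual_map_def e1_def e2_def on_levels_def)
  then show ?thesis by blast
qed

end

theory Submission
  imports Defs "HOL-Analysis.Determinants" "HOL-Computational_Algebra.Polynomial"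
begin

text \<open>
  An edge from \<open>u\<close> to \<open>v\<close> with label \<open>p\<close> carries the matrix \<open>1 + x p P\<close>, where \<open>P\<close> projects onto the
  line \<open>u\<close> along the line \<open>v\<close>; the cross-ratio relation says that these matrices multiply to the
  same product along both sides of a quad. Since level 0 is constant, the monodromy matrix \<open>M\<close>
  based there is lower triangular with diagonal entries \<open>b = \<Prod>(1 + x \<beta>)\<close> and \<open>a = \<Prod>(1 + x \<alpha>)\<close>.
  Let \<open>A\<close> be the product along the straight line of \<open>N = 2 m - 1\<close> edges from level 0 to the point
  \<open>y\<close> of level \<open>2 m - 1\<close>. Consecutive projections on a straight line annihilate each other, so
  \<open>A y\<close> has degree at most \<open>m - 1\<close> in \<open>x\<close>, and the second component \<open>f\<close> of \<open>(M - b) A y\<close> has degree at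
  most \<open>N\<close>. With \<open>M'\<close> the monodromy at \<open>y\<close>, multiplication by the adjugate of \<open>A\<close> gives
  \<open>f adj(A) e\<^sub>2 = det(A) (M' - b) y\<close>. The vector \<open>adj(A) e\<^sub>2\<close> never vanishes if no \<open>\<alpha>\<close> equals a \<open>\<beta>\<close>, so
  \<open>det(A)\<close>, which has degree \<open>N\<close>, divides \<open>f\<close>; as \<open>f(0) = 0\<close>, this forces \<open>f = 0\<close>. The derivative of \<open>f\<close>
  at 0 is the claim. Labels with \<open>\<alpha>\<^sub>i = \<beta>\<^sub>j\<close> are reached in the limit from \<open>\<alpha> + \<epsilon>\<close>.
\<close>


section \<open>Edge matrices\<close>

definition br :: "complex^2 \<Rightarrow> complex^2 \<Rightarrow> complex" where
  "br u v = u $ 1 * v $ 2 - v $ 1 * u $ 2"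

text \<open>The map \<open>w\<close> to \<open>(br w v / br u v) *s u\<close>. It is unchanged when
  \<open>u\<close> or \<open>v\<close> is rescaled by a nonzero factor, so it depends only on the
  two projective points.\<close>

definition edge_proj :: "complex^2 \<Rightarrow> complex^2 \<Rightarrow> complex^2^2" where
  "edge_proj u v = (\<chi> i j. u $ i * (if j = 1 then v $ 2 else - (v $ 1)) / br u v)"

definition edge_mat :: "complex \<Rightarrow> complex^2 \<Rightarrow> complex^2 \<Rightarrow> complex^2^2" where
  "edge_mat t u v = (\<chi> i j. (if i = j then 1 else 0) + t * edge_proj u v $ i $ j)"

lemmas mat2 = vec_eq_iff forall_2 sum_2 matrix_matrix_mult_def matrix_vector_mult_def

lemma edge_mat_mult_vec:
  "edge_mat t u v *v w = w + (t * (br w v / br u v)) *s u"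
  by (simp add: mat2 edge_mat_def edge_proj_def br_def ring_distribs diff_divide_distrib mult_ac)

text \<open>The projections onto \<open>u\<close> along \<open>v\<close> and onto \<open>v\<close>
  along \<open>u\<close> add up to 1 and annihilate each other. So the reversed edge carries the
  adjugate.\<close>

lemma edge_mat_rev:
  assumes "br u v \<noteq> 0"
  shows "edge_mat t u v ** edge_mat t v u = mat (1 + t)"
  unfolding matrix_eq
proof
  fix w
  have sw: "br v u = - br u v" by (simp add: br_def)
  have br_lin: "br (w + s *s v) v = br w v" for s by (simp add: br_def algebra_simps)
  \<comment> \<open>Cramer's rule for \<open>w\<close> in the basis \<open>u\<close>,
    \<open>v\<close>.\<close>
  have span: "br w v * u $ i - br w u * v $ i = br u v * w $ i" for i
    using exhaust_2[of i] by (auto simp: br_def algebra_simps)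
  have "(edge_mat t u v ** edge_mat t v u) *v w
      = w + (t / br u v) *s (br w v *s u - br w u *s v)"
    unfolding matrix_vector_mul_assoc[symmetric] edge_mat_mult_vec br_lin
    by (simp add: vec_eq_iff sw algebra_simps)
  also have "br w v *s u - br w u *s v = br u v *s w"
    by (simp add: vec_eq_iff span)
  finally show "(edge_mat t u v ** edge_mat t v u) *v w = mat (1 + t) *v w"
    using assms by (simp add: mat2 mat_def algebra_simps)
qed

text \<open>The two sides follow the quad from \<open>d\<close> to \<open>b\<close> through
  \<open>c\<close> and through \<open>a\<close>. Their quadratic terms in \<open>x\<close> vanish,
  and the cross-ratio relation matches the linear ones.\<close>

lemma edge_mat_flat:
  assumes "q * (br a b * br c d) = p * (br b c * br d a)"
    and "br a b \<noteq> 0" "br c d \<noteq> 0" "br b c \<noteq> 0" "br d a \<noteq> 0"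
  shows "edge_mat (x * p) d c ** edge_mat (x * q) c b = edge_mat (x * q) d a ** edge_mat (x * p) a b"
  unfolding matrix_eq
proof
  fix w
  \<comment> \<open>Both labels are multiples of \<open>k\<close>, which clears all denominators and
    leaves a polynomial identity.\<close>
  define k where "k = q / (br b c * br d a)"
  have q: "q = k * (br b c * br d a)" using assms by (simp add: k_def)
  have p: "p = k * (br a b * br c d)" using assms by (simp add: k_def field_simps)
  have sw: "br d c = - br c d" "br c b = - br b c"  by (simp_all add: br_def)
  have br_lin: "br (u + s *s u') v = br u v + s * br u' v" for u u' v s by (simp add: br_def algebra_simps)
  have self: "br u u = 0" for u by (simp add: br_def)
  have step: "edge_mat (x * p) d c *v w = w - (x * k * br a b * br w c) *s d"
    "edge_mat (x * p) a b *v w = w + (x * k * br c d * br w b) *s a"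
    "edge_mat (x * q) c b *v w = w - (x * k * br d a * br w b) *s c"
    "edge_mat (x * q) d a *v w = w + (x * k * br b c * br w a) *s d" for w
    using assms(2-) by (simp_all add: edge_mat_mult_vec p q sw vec_eq_iff)
  show "(edge_mat (x * p) d c ** edge_mat (x * q) c b) *v w = (edge_mat (x * q) d a ** edge_mat (x * p) a b) *v w"
    unfolding matrix_vector_mul_assoc[symmetric] step
    by (simp add: vec_eq_iff forall_2 br_def) algebra
qed


section \<open>Polynomial functions of bounded degree\<close>

definition poly_deg_le :: "nat \<Rightarrow> (complex \<Rightarrow> complex) \<Rightarrow> bool" where
  "poly_deg_le d f \<longleftrightarrow> (\<exists>p. degree p \<le> d \<and> f = poly p)"

lemma poly_deg_leE:
  assumes "poly_deg_le d f"
  obtains p where "degree p \<le> d" "f = poly p"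
  using assms unfolding poly_deg_le_def by blast

lemma poly_deg_le_const [intro]: "poly_deg_le d (\<lambda>x. c)"
  unfolding poly_deg_le_def by (rule exI[of _ "[:c:]"]) auto

lemma poly_deg_le_add:
  assumes "poly_deg_le d f" "poly_deg_le d g"
  shows "poly_deg_le d (\<lambda>x. f x + g x)"
proof -
  obtain p q where "degree p \<le> d" "f = poly p" "degree q \<le> d" "g = poly q"
    using assms by (auto simp: poly_deg_le_def)
  then show ?thesis unfolding poly_deg_le_def
    using degree_add_le[of p d q] by (intro exI[of _ "p + q"]) (auto simp: fun_eq_iff)
qed

lemma poly_deg_le_diff:
  assumes "poly_deg_le d f" "poly_deg_le d g"
  shows "poly_deg_le d (\<lambda>x. f x - g x)"
proof -
  obtain p q where "degree p \<le> d" "f = poly p" "degree q \<le> d" "g = poly q"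
    using assms by (auto simp: poly_deg_le_def)
  then show ?thesis unfolding poly_deg_le_def
    using degree_diff_le[of p d q] by (intro exI[of _ "p - q"]) (auto simp: fun_eq_iff)
qed

lemma poly_deg_le_mult:
  assumes "poly_deg_le d f" "poly_deg_le e g"
  shows "poly_deg_le (d + e) (\<lambda>x. f x * g x)"
proof -
  obtain p q where "degree p \<le> d" "f = poly p" "degree q \<le> e" "g = poly q"
    using assms by (auto simp: poly_deg_le_def)
  then show ?thesis unfolding poly_deg_le_def
    using degree_mult_le[of p q] by (intro exI[of _ "p * q"]) (auto simp: fun_eq_iff)
qed

lemma poly_deg_le_linear: "poly_deg_le 1 (\<lambda>x. c + x * b)"
  unfolding poly_deg_le_def by (rule exI[of _ "[:c,b:]"]) auto

definition mat_deg_le :: "nat \<Rightarrow> (complex \<Rightarrow> complex^2^2) \<Rightarrow> bool" where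
  "mat_deg_le d F \<longleftrightarrow> (\<forall>i j. poly_deg_le d (\<lambda>x. F x $ i $ j))"

lemma mat_deg_le_mult:
  assumes "mat_deg_le d F" "mat_deg_le e G"
  shows "mat_deg_le (d + e) (\<lambda>x. F x ** G x)"
  using assms unfolding mat_deg_le_def
  by (auto simp: matrix_matrix_mult_def sum_2 intro!: poly_deg_le_add poly_deg_le_mult)

lemma mat_deg_le_const: "mat_deg_le d (\<lambda>x. A)"
  by (auto simp: mat_deg_le_def)

lemma mat_deg_le_edge: "mat_deg_le 1 (\<lambda>x. edge_mat (x * p) u v)"
  unfolding mat_deg_le_def edge_mat_def
  by (simp add: mult.assoc poly_deg_le_linear[unfolded One_nat_def])

text \<open>The image \<open>v\<close> of the second projection lies in the kernel of the first, so
  two consecutive edges cost only one degree.\<close>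

lemma mat_deg_le_two_edges:
  "mat_deg_le 1 (\<lambda>x. edge_mat (x * p) u v ** edge_mat (x * q) v w)"
proof -
  have "edge_mat (x * p) u v ** edge_mat (x * q) v w
     = (\<chi> i j. (if i = j then 1 else 0) + x * (p * edge_proj u v $ i $ j + q * edge_proj v w $ i $ j))" for x
    by (simp add: mat2 edge_mat_def edge_proj_def algebra_simps)
  then show ?thesis unfolding mat_deg_le_def
    by (simp add: poly_deg_le_linear[unfolded One_nat_def])
qed

text \<open>At the root of a linear factor, \<open>V1\<close> or \<open>V2\<close> is nonzero, so
  \<open>F\<close> vanishes there. Removing one factor at a time takes care of repeated
  roots.\<close>

lemma prod_linear_dvd_cancel:
  fixes F V1 V2 :: "complex poly" and N :: nat
  assumes v: "\<And>x. \<not> (poly V1 x = 0 \<and> poly V2 x = 0)"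
    and nz: "\<And>s. s < N \<Longrightarrow> c s \<noteq> 0"
    and "(\<Prod>s<N. [:1, c s:]) dvd V1 * F" "(\<Prod>s<N. [:1, c s:]) dvd V2 * F"
  shows "(\<Prod>s<N. [:1, c s:]) dvd F"
  using nz assms(3,4)
proof (induction N arbitrary: F)
  case (Suc N)
  define l where "l = [:1, c N:]"
  have c: "c N \<noteq> 0" using Suc.prems by simp
  then have l: "l = smult (c N) [:- (- 1 / c N), 1:]" by (simp add: l_def)
  have "l dvd V1 * F" "l dvd V2 * F"
    using Suc.prems(2,3) unfolding prod.lessThan_Suc l_def[symmetric] by (auto dest: dvd_mult_right)
  moreover have "poly l (- 1 / c N) = 0" using c by (simp add: l_def)
  then have "poly G (- 1 / c N) = 0" if "l dvd G" for G using that by (auto elim!: dvdE)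
  ultimately have "poly (V1 * F) (- 1 / c N) = 0" "poly (V2 * F) (- 1 / c N) = 0" by blast+
  with v[of "- 1 / c N"] have "poly F (- 1 / c N) = 0" by auto
  then have "[:- (- 1 / c N), 1:] dvd F" unfolding poly_eq_0_iff_dvd .
  then have "l dvd F" unfolding l using c by (rule smult_dvd)
  then obtain G where "F = l * G" by (rule dvdE)
  then have G: "F = G * l" by (simp only: mult.commute)
  define P where "P = (\<Prod>s<N. [:1, c s:])"
  have "l \<noteq> 0" by (simp add: l_def)
  have cancel: "P dvd H" if "P * l dvd H * l" for H
    using that \<open>l \<noteq> 0\<close> dvd_mult_cancel_right[of P l H] by simp
  have "P * l dvd (V1 * G) * l" "P * l dvd (V2 * G) * l"
    using Suc.prems(2,3) unfolding G prod.lessThan_Suc P_def l_def mult.assoc .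
  note this[THEN cancel]
  then have "P dvd G" unfolding P_def using Suc.prems(1) by (rule Suc.IH[rotated 1]) simp_all
  then show ?case unfolding G prod.lessThan_Suc P_def l_def by (rule mult_dvd_mono) simp
qed simp

text \<open>The product has degree exactly \<open>N\<close> and divides \<open>f\<close>, so
  \<open>f\<close> is a constant multiple of it; at 0 the product is 1 and \<open>f\<close> is
  0.\<close>

lemma poly_prod_linear_rigid:
  assumes f: "poly_deg_le N f" "f 0 = 0"
    and v: "poly_deg_le d1 v1" "poly_deg_le d2 v2" "\<And>x. \<not> (v1 x = 0 \<and> v2 x = 0)"
    and w: "poly_deg_le e1 w1" "poly_deg_le e2 w2"
    and nz: "\<And>s. s < N \<Longrightarrow> c s \<noteq> 0"
    and eq: "\<And>x. v1 x * f x = (\<Prod>s<N. 1 + x * c s) * w1 x"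
            "\<And>x. v2 x * f x = (\<Prod>s<N. 1 + x * c s) * w2 x"
  shows "f x = 0"
proof -
  obtain F where F: "degree F \<le> N" "f = poly F" using f(1) by (rule poly_deg_leE)
  obtain V1 where V1: "v1 = poly V1" using v(1) by (rule poly_deg_leE)
  obtain V2 where V2: "v2 = poly V2" using v(2) by (rule poly_deg_leE)
  obtain W1 where W1: "w1 = poly W1" using w(1) by (rule poly_deg_leE)
  obtain W2 where W2: "w2 = poly W2" using w(2) by (rule poly_deg_leE)
  note V = V1 V2 and W = W1 W2
  define P where "P = (\<Prod>s<N. [:1, c s:])"
  have P: "poly P x = (\<Prod>s<N. 1 + x * c s)" for x by (simp add: P_def poly_prod)
  have "V1 * F = P * W1"
    by (rule poly_eq_poly_eq_iff[THEN iffD1], rule ext) (use eq(1) in \<open>simp add: F V W P\<close>)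
  moreover have "V2 * F = P * W2"
    by (rule poly_eq_poly_eq_iff[THEN iffD1], rule ext) (use eq(2) in \<open>simp add: F V W P\<close>)
  ultimately have "P dvd V1 * F" "P dvd V2 * F" by auto
  then have "P dvd F" unfolding P_def
    by (rule prod_linear_dvd_cancel[rotated 2]) (use v(3) nz V in simp_all)
  then obtain h where h: "F = P * h" by (rule dvdE)
  have dP: "degree P = (\<Sum>s<N. degree [:1, c s:])" unfolding P_def
    by (rule degree_prod_eq_sum_degree) simp
  also have "\<dots> = (\<Sum>s<N. 1)"
    using nz by (intro sum.cong) simp_all
  finally have dP: "degree P = N" by simp
  have "F = 0"
  proof (rule ccontr)
    assume "F \<noteq> 0"
    then have "P \<noteq> 0" "h \<noteq> 0" unfolding h by simp_all
    then have "degree F = N + degree h" unfolding h dP[symmetric] by (rule degree_mult_eq)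
    then have "degree h = 0" using F(1) by linarith
    then obtain k where k: "h = [:k:]" by (rule degree_eq_zeroE)
    have "poly P 0 * poly h 0 = 0" using f(2) F(2) h by (metis poly_mult)
    then have "k = 0" unfolding P k by simp
    with k \<open>h \<noteq> 0\<close> show False by simp
  qed
  then show ?thesis unfolding F(2) by simp
qed


section \<open>Monodromy for distinct labels\<close>

primrec mprod :: "(nat \<Rightarrow> complex^2^2) \<Rightarrow> nat \<Rightarrow> complex^2^2" where
  "mprod F 0 = mat 1"
| "mprod F (Suc n) = mprod F n ** F n"

lemma mprod_cong: "(\<And>l. l < n \<Longrightarrow> F l = G l) \<Longrightarrow> mprod F n = mprod G n"
  by (induction n) auto

text \<open>Two bracketings of one alternating word; this moves the base point of a zigzag by one
  edge.\<close>

lemma mprod_regroup: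
  "r 0 ** mprod (\<lambda>l. d l ** r (Suc l)) n = mprod (\<lambda>l. r l ** d l) n ** r n"
proof (induction n)
  case (Suc n)
  have "r 0 ** mprod (\<lambda>l. d l ** r (Suc l)) (Suc n)
      = (r 0 ** mprod (\<lambda>l. d l ** r (Suc l)) n) ** (d n ** r (Suc n))"
    by (simp add: matrix_mul_assoc)
  then show ?case by (simp only: Suc.IH mprod.simps matrix_mul_assoc)
qed (simp add: matrix_mul_lid matrix_mul_rid)

lemma mat_deg_le_mprod:
  assumes "\<And>l. mat_deg_le e (\<lambda>x. F x l)"
  shows "mat_deg_le (n * e) (\<lambda>x. mprod (F x) n)"
proof (induction n)
  case (Suc n)
  show ?case using mat_deg_le_mult[OF Suc assms[of n]] by (simp add: add.commute)
qed (simp add: mat_deg_le_const)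

lemma mat_mult_scalar:
  fixes M :: "complex^2^2"
  shows "mat c ** M = M ** mat c" and "mat c ** (mat d :: complex^2^2) = mat (c * d)"
    and "mat c *v w = c *s (w :: complex^2)"
  by (simp_all add: mat2 mat_def)

lemma mat_deg_le_mult_vec:
  assumes "mat_deg_le d F"
  shows "poly_deg_le d (\<lambda>x. (F x *v w) $ i)"
proof -
  have "poly_deg_le d (\<lambda>x. F x $ i $ j * w $ j)" for j
    using poly_deg_le_mult[of d "\<lambda>x. F x $ i $ j" 0 "\<lambda>x. w $ j"] assms
    by (auto simp: mat_deg_le_def)
  then show ?thesis unfolding matrix_vector_mult_def
    by (simp add: sum_2 poly_deg_le_add)
qed

lemma poly_deg_le_deriv:
  assumes "poly_deg_le d f"
  shows "\<exists>f'. (f has_field_derivative f') (at x)"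
  using assms by (auto simp: poly_deg_le_def intro: poly_DERIV)

lemma derivative_prod_linear:
  fixes c :: "nat \<Rightarrow> complex"
  shows "((\<lambda>x. \<Prod>l<n. 1 + x * c l) has_field_derivative (\<Sum>l<n. c l)) (at 0)"
proof (induction n)
  case (Suc n)
  have "((\<lambda>x. (\<Prod>l<n. 1 + x * c l) * (1 + x * c n)) has_field_derivative (\<Sum>l<n. c l) + c n) (at 0)"
    by (rule derivative_eq_intros Suc refl)+ simp
  then show ?case by simp
qed simp

text \<open>Homogeneous coordinates \<open>X k i\<close> of the point \<open>z\<close> at the vertex \<open>(i, k - i)\<close>, so that \<open>k\<close> is the
  level.\<close>

locale cr_lattice =
  fixes m :: nat and \<alpha> \<beta> :: "int \<Rightarrow> complex" and X :: "nat \<Rightarrow> int \<Rightarrow> complex^2"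
  assumes m_pos: "m \<ge> 1"
    and per_\<alpha>: "\<And>i. \<alpha> (i + int m) = \<alpha> i"
    and per_X: "\<And>k i. X k (i + int m) = X k i"
    and \<alpha>_nz: "\<And>i. \<alpha> i \<noteq> 0"
    and labels_distinct: "\<And>i j. \<alpha> i \<noteq> \<beta> j"
    and base: "\<And>i. X 0 i = vector [0, 1]"
    and nd_right: "\<And>k i. k < 2 * m - 1 \<Longrightarrow> br (X k i) (X (Suc k) (i + 1)) \<noteq> 0"
    and nd_up: "\<And>k i. k < 2 * m - 1 \<Longrightarrow> br (X k i) (X (Suc k) i) \<noteq> 0"
    and cross: "\<And>k i. Suc k < 2 * m - 1 \<Longrightarrow>
        \<beta> (int k - i) * (br (X k i) (X (Suc k) (i + 1)) * br (X (Suc (Suc k)) (i + 1)) (X (Suc k) i))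
      = \<alpha> i * (br (X (Suc k) (i + 1)) (X (Suc (Suc k)) (i + 1)) * br (X (Suc k) i) (X k i))"
begin

section \<open>Edge matrices on the lattice and flips across quads\<close>

definition rt :: "complex \<Rightarrow> nat \<Rightarrow> int \<Rightarrow> complex^2^2" where
  "rt x k i = edge_mat (x * \<alpha> i) (X k i) (X (Suc k) (i + 1))"

text \<open>Oriented downwards, so that \<open>rt x k i ** dn x k (i + 1)\<close> runs along a
  zigzag to the next vertex of level \<open>k\<close>.\<close>

definition dn :: "complex \<Rightarrow> nat \<Rightarrow> int \<Rightarrow> complex^2^2" where
  "dn x k i = edge_mat (x * \<beta> (int k - i)) (X (Suc k) i) (X k i)"

text \<open>A path over the top of a quad, at level \<open>k + 2\<close>, is pushed to its bottom at
  level \<open>k\<close>.\<close>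

lemma flat:
  assumes "Suc k < 2 * m - 1"
  shows "rt x (Suc k) i ** dn x (Suc k) (i + 1) = dn x k i ** rt x k i"
proof -
  have sw: "br u v \<noteq> 0 \<Longrightarrow> br v u \<noteq> 0" for u v by (auto simp: br_def)
  show ?thesis
    unfolding rt_def dn_def
    using edge_mat_flat[OF cross[OF assms, of i], of x] assms
      nd_right[of k i] nd_up[of k i, THEN sw] nd_right[of "Suc k" i, THEN sw] nd_up[of "Suc k" "i + 1"]
    by simp
qed

text \<open>One period of the zigzag between levels \<open>s\<close> and \<open>s + 1\<close>, based
  at the vertex \<open>(s, 0)\<close>; \<open>mono_dn\<close> is based at \<open>(s + 1, 0)\<close>.
  The base points move along a straight line of \<alpha>-edges.\<close>

definition mono_up :: "complex \<Rightarrow> nat \<Rightarrow> complex^2^2" where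
  "mono_up x s = mprod (\<lambda>l. rt x s (int s + int l) ** dn x s (int s + int l + 1)) m"

definition mono_dn :: "complex \<Rightarrow> nat \<Rightarrow> complex^2^2" where
  "mono_dn x s = mprod (\<lambda>l. dn x s (int s + int l + 1) ** rt x s (int s + int l + 1)) m"

definition step :: "complex \<Rightarrow> nat \<Rightarrow> complex^2^2" where
  "step x s = rt x s (int s)"

text \<open>The adjugate of \<open>step\<close>, used in place of an inverse because
  \<open>step\<close> is singular for one value of \<open>x\<close>.\<close>

definition step_rev :: "complex \<Rightarrow> nat \<Rightarrow> complex^2^2" where
  "step_rev x s = edge_mat (x * \<alpha> (int s)) (X (Suc s) (int s + 1)) (X s (int s))"

lemma mono_dn_eq_mono_up: "Suc s < 2 * m - 1 \<Longrightarrow> mono_dn x s = mono_up x (Suc s)"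
  unfolding mono_dn_def mono_up_def
  using flat[of s x "int s + int l + 1" for l] by (intro mprod_cong) (simp add: add_ac)

lemma rt_periodic: "rt x s (i + int m) = rt x s i"
proof -
  have "X (Suc s) (i + int m + 1) = X (Suc s) (i + 1)"
    using per_X[of "Suc s" "i + 1"] by (simp add: add_ac)
  then show ?thesis by (simp add: rt_def per_X per_\<alpha>)
qed

text \<open>By periodicity the first edge of the zigzag can be moved to its end. The factored form
  expresses conjugation by \<open>step\<close> without inverting it.\<close>

lemma mono_factor:
  obtains R where "mono_up x s = step x s ** R" "mono_dn x s = R ** step x s"
proof -
  obtain n where n: "m = Suc n" using m_pos by (cases m) auto
  define r d where "r l = rt x s (int s + int l)" and "d l = dn x s (int s + int l + 1)" for l
  have up: "mono_up x s = mprod (\<lambda>l. r l ** d l) (Suc n)"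
    by (simp add: mono_up_def r_def d_def flip: n)
  have dn: "mono_dn x s = mprod (\<lambda>l. d l ** r (Suc l)) (Suc n)"
    by (simp add: mono_dn_def r_def d_def add_ac flip: n)
  have r: "r 0 = step x s" "r (Suc n) = step x s"
    using rt_periodic[of x s "int s"] unfolding r_def step_def n by simp_all
  define R where "R = mprod (\<lambda>l. d l ** r (Suc l)) n ** d n"
  have "mono_up x s = step x s ** R"
    using mprod_regroup[of r d n] unfolding up R_def r(1) by (simp add: matrix_mul_assoc)
  moreover have "mono_dn x s = R ** step x s"
    unfolding dn R_def by (simp add: r(2) matrix_mul_assoc)
  ultimately show thesis by (rule that)
qed

lemma step_rev_mult:
  assumes "s < 2 * m - 1"
  shows "step x s ** step_rev x s = mat (1 + x * \<alpha> (int s))"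
    and "step_rev x s ** step x s = mat (1 + x * \<alpha> (int s))"
proof -
  have "br (X (Suc s) (int s + 1)) (X s (int s)) \<noteq> 0"
    using nd_right[OF assms, of "int s"] by (auto simp: br_def)
  then show "step x s ** step_rev x s = mat (1 + x * \<alpha> (int s))"
    and "step_rev x s ** step x s = mat (1 + x * \<alpha> (int s))"
    using nd_right[OF assms, of "int s"]
    by (simp_all add: step_def rt_def step_rev_def edge_mat_rev)
qed

section \<open>Transport along a straight line\<close>

definition line :: "complex \<Rightarrow> nat \<Rightarrow> complex^2^2" where
  "line x s = mprod (step x) s"

primrec line_rev :: "complex \<Rightarrow> nat \<Rightarrow> complex^2^2" where
  "line_rev x 0 = mat 1"
| "line_rev x (Suc s) = step_rev x s ** line_rev x s"

lemma line_rev_mult: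
  "s \<le> 2 * m - 1 \<Longrightarrow> line_rev x s ** line x s = mat (\<Prod>t<s. 1 + x * \<alpha> (int t))"
proof (induction s)
  case (Suc s)
  have "line_rev x (Suc s) ** line x (Suc s)
      = step_rev x s ** (line_rev x s ** line x s) ** step x s"
    by (simp add: line_def matrix_mul_assoc)
  also have "\<dots> = mat (\<Prod>t<s. 1 + x * \<alpha> (int t)) ** (step_rev x s ** step x s)"
    using Suc by (simp add: mat_mult_scalar(1)[of _ "step_rev x s"] matrix_mul_assoc)
  finally show ?case using Suc.prems by (simp add: step_rev_mult mat_mult_scalar(2))
qed (simp add: line_def matrix_mul_lid)

text \<open>The base point crosses one strip by \<open>mono_factor\<close>; flips of all quads pass
  from one strip to the next.\<close>

lemma line_intertwines:
  "s < 2 * m - 1 \<Longrightarrow> line x (Suc s) ** mono_dn x s = mono_up x 0 ** line x (Suc s)"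
proof (induction s)
  case 0
  obtain R where "mono_up x 0 = step x 0 ** R" "mono_dn x 0 = R ** step x 0" by (rule mono_factor)
  then show ?case by (simp add: line_def matrix_mul_lid matrix_mul_assoc)
next
  case (Suc s)
  obtain R where R: "mono_up x (Suc s) = step x (Suc s) ** R" "mono_dn x (Suc s) = R ** step x (Suc s)"
    by (rule mono_factor)
  have "line x (Suc (Suc s)) ** mono_dn x (Suc s) = (line x (Suc s) ** mono_up x (Suc s)) ** step x (Suc s)"
    by (simp add: line_def R matrix_mul_assoc)
  also have "\<dots> = mono_up x 0 ** line x (Suc (Suc s))"
    using Suc mono_dn_eq_mono_up[of s x] by (simp add: line_def matrix_mul_assoc)
  finally show ?case .
qed

section \<open>The monodromy based at the constant level\<close>

definition ev_\<alpha> :: "complex \<Rightarrow> nat \<Rightarrow> complex" where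
  "ev_\<alpha> x n = (\<Prod>l<n. 1 + x * \<alpha> (int l))"

definition ev_\<beta> :: "complex \<Rightarrow> nat \<Rightarrow> complex" where
  "ev_\<beta> x n = (\<Prod>l<n. 1 + x * \<beta> (- int l - 1))"

text \<open>This is \<open>1 / z\<close> at the vertex \<open>(l + 1, - l)\<close> of level 1, and 0
  if \<open>z\<close> is infinite.\<close>

definition slope :: "nat \<Rightarrow> complex" where
  "slope l = X 1 (int l + 1) $ 2 / X 1 (int l + 1) $ 1"

text \<open>The common point \<open>vector [0, 1]\<close> of level 0 spans the image of the
  projection in \<open>rt\<close> and the kernel of that in \<open>dn\<close>, so both factors are
  lower triangular.\<close>

lemma base_step:
  "rt x 0 (int l) ** dn x 0 (int l + 1) = (\<chi> i j. if i = 1 then (if j = 1 then 1 + x * \<beta> (- int l - 1) else 0)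
     else (if j = 1 then x * slope l * (\<beta> (- int l - 1) - \<alpha> (int l)) else 1 + x * \<alpha> (int l)))"
proof -
  have nz: "X 1 (int l + 1) $ 1 \<noteq> 0"
    using nd_right[of 0 "int l"] m_pos by (auto simp: br_def base)
  have "rt x 0 (int l) = (\<chi> i j. if i = 1 then (if j = 1 then 1 else 0)
     else (if j = 1 then - (x * slope l * \<alpha> (int l)) else 1 + x * \<alpha> (int l)))"
    using nz by (simp add: rt_def edge_mat_def edge_proj_def base br_def slope_def mat2)
  moreover have "dn x 0 (int l + 1) = (\<chi> i j. if i = 1 then (if j = 1 then 1 + x * \<beta> (- int l - 1) else 0)
     else (if j = 1 then x * slope l * \<beta> (- int l - 1) else 1))"
    using nz by (simp add: dn_def edge_mat_def edge_proj_def base br_def slope_def mat2)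
  ultimately show ?thesis by (simp add: mat2 algebra_simps)
qed

definition base_mono :: "complex \<Rightarrow> nat \<Rightarrow> complex^2^2" where
  "base_mono x n = mprod (\<lambda>l. rt x 0 (int l) ** dn x 0 (int l + 1)) n"

lemma base_mono_Suc:
  "base_mono x (Suc n) $ i $ 1 = base_mono x n $ i $ 1 * (1 + x * \<beta> (- int n - 1))
     + base_mono x n $ i $ 2 * (x * slope n * (\<beta> (- int n - 1) - \<alpha> (int n)))"
  "base_mono x (Suc n) $ i $ 2 = base_mono x n $ i $ 2 * (1 + x * \<alpha> (int n))"
proof -
  have "base_mono x (Suc n) = base_mono x n ** (rt x 0 (int n) ** dn x 0 (int n + 1))"
    by (simp add: base_mono_def)
  note * = this[unfolded base_step]
  show "base_mono x (Suc n) $ i $ 1 = base_mono x n $ i $ 1 * (1 + x * \<beta> (- int n - 1))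
     + base_mono x n $ i $ 2 * (x * slope n * (\<beta> (- int n - 1) - \<alpha> (int n)))"
    "base_mono x (Suc n) $ i $ 2 = base_mono x n $ i $ 2 * (1 + x * \<alpha> (int n))"
    unfolding * by (simp_all add: matrix_matrix_mult_def sum_2)
qed

lemma base_mono_0: "base_mono x 0 = mat 1"
  by (simp add: base_mono_def)

lemma base_mono_at_0: "base_mono 0 n $ 2 $ 1 = 0"
  by (induction n) (simp_all add: base_mono_0 base_mono_Suc mat_def)

lemma base_mono_entries:
  "base_mono x n $ 1 $ 1 = ev_\<beta> x n" "base_mono x n $ 1 $ 2 = 0" "base_mono x n $ 2 $ 2 = ev_\<alpha> x n"
  by (induction n) (simp_all add: base_mono_0 base_mono_Suc ev_\<alpha>_def ev_\<beta>_def mat_def)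

lemma mono_up_0: "mono_up x 0 = base_mono x m"
  by (simp add: mono_up_def base_mono_def)

section \<open>The transported eigenvector\<close>

definition eigvec :: "complex \<Rightarrow> nat \<Rightarrow> complex^2" where
  "eigvec x s = line_rev x s *v vector [0, 1]"

lemma eigvec_Suc: "eigvec x (Suc s) = step_rev x s *v eigvec x s"
  by (simp add: eigvec_def matrix_vector_mul_assoc)

text \<open>Triangularity makes \<open>vector [0, 1]\<close> an eigenvector at level 0, and each
  adjugate carries it one level up with the same eigenvalue.\<close>

lemma mono_up_eigvec:
  "s < 2 * m - 1 \<Longrightarrow> mono_up x s *v eigvec x s = ev_\<alpha> x m *s eigvec x s"
proof (induction s)
  case 0
  show ?case using base_mono_entries[of x m]
    by (simp add: mono_up_0 eigvec_def mat2 mat_def)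
next
  case (Suc s)
  then have s: "s < 2 * m - 1" by simp
  obtain R where R: "mono_up x s = step x s ** R" "mono_dn x s = R ** step x s" by (rule mono_factor)
  have "mono_up x (Suc s) *v eigvec x (Suc s) = (R ** (step x s ** step_rev x s)) *v eigvec x s"
    unfolding mono_dn_eq_mono_up[OF Suc.prems, symmetric] R(2) eigvec_Suc
    by (simp add: matrix_vector_mul_assoc matrix_mul_assoc)
  \<comment> \<open>The product of \<open>step\<close> and \<open>step_rev\<close> is scalar in
    either order, so it commutes with \<open>R\<close>.\<close>
  also have "\<dots> = (step_rev x s ** (step x s ** R)) *v eigvec x s"
    using step_rev_mult[OF s] by (simp add: matrix_mul_assoc mat_mult_scalar(1))
  also have "\<dots> = step_rev x s *v (mono_up x s *v eigvec x s)"
    unfolding R(1) by (simp add: matrix_vector_mul_assoc)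
  also have "\<dots> = ev_\<alpha> x m *s eigvec x (Suc s)"
    using Suc s by (simp add: eigvec_Suc vector_scalar_commute)
  finally show ?case .
qed

lemma trace_mono_up: "s < 2 * m - 1 \<Longrightarrow> trace (mono_up x s) = ev_\<alpha> x m + ev_\<beta> x m"
proof (induction s)
  case 0
  then show ?case by (simp add: mono_up_0 trace_def sum_2 base_mono_entries)
next
  case (Suc s)
  obtain R where R: "mono_up x s = step x s ** R" "mono_dn x s = R ** step x s" by (rule mono_factor)
  have "trace (mono_dn x s) = trace (mono_up x s)" unfolding R by (rule trace_mul_sym)
  with Suc show ?case by (simp add: mono_dn_eq_mono_up)
qed

lemma \<alpha>_mod: "\<alpha> (int s) = \<alpha> (int (s mod m))"
proof -
  have "\<alpha> (int r + int q * int m) = \<alpha> (int r)" for r q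
  proof (induction q)
    case (Suc q)
    then show ?case using per_\<alpha>[of "int r + int q * int m"] by (simp add: algebra_simps)
  qed simp
  from this[of "s mod m" "s div m"] show ?thesis
    by (metis of_nat_add of_nat_mult mod_div_mult_eq add.commute mult.commute)
qed

text \<open>If the vector first died at edge \<open>s\<close>, then
  \<open>1 + x * \<alpha> (int s) = 0\<close>. So \<open>ev_\<alpha>\<close> vanishes, while
  \<open>ev_\<beta>\<close> does not because the labels are distinct; the trace gives the
  contradiction.\<close>

lemma eigvec_nonzero: "s \<le> 2 * m - 1 \<Longrightarrow> eigvec x s \<noteq> 0"
proof (induction s)
  case 0
  then show ?case by (simp add: eigvec_def vec_eq_iff forall_2)
next
  case (Suc s)
  then have s: "s < 2 * m - 1" and v: "eigvec x s \<noteq> 0" by auto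
  show ?case
  proof
    assume 0: "eigvec x (Suc s) = 0"
    have "(step x s ** step_rev x s) *v eigvec x s = 0"
      using 0 by (simp add: eigvec_Suc flip: matrix_vector_mul_assoc)
    then have x: "x * \<alpha> (int s) = - 1"
      using v by (simp add: step_rev_mult[OF s] mat_mult_scalar(3) vec_eq_iff eq_neg_iff_add_eq_0) (metis add.commute)
    \<comment> \<open>The index \<open>s\<close> may exceed \<open>m - 1\<close>; its residue names
      a factor of \<open>ev_\<alpha>\<close>.\<close>
    have "1 + x * \<alpha> (int (s mod m)) = 0" using x \<alpha>_mod[of s] by simp
    then have a: "ev_\<alpha> x m = 0"
      using m_pos by (auto simp: ev_\<alpha>_def intro!: bexI[of _ "s mod m"])
    have b: "ev_\<beta> x m \<noteq> 0"
    proof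
      assume "ev_\<beta> x m = 0"
      then obtain l where "x * \<beta> l = - 1" by (auto simp: ev_\<beta>_def eq_neg_iff_add_eq_0 add.commute)
      with x have "x * \<alpha> (int s) = x * \<beta> l" "x \<noteq> 0" by auto
      then show False using labels_distinct by auto
    qed
    define p q v where "p = X s (int s)" and "q = X (Suc s) (int s + 1)" and "v = eigvec x s"
    have pq: "br p q \<noteq> 0" using nd_right[OF s, of "int s"] by (simp add: p_def q_def)
    have qp: "br q p = - br p q" by (simp add: br_def)
    obtain R where R: "mono_up x s = step x s ** R" by (rule mono_factor)
    \<comment> \<open>Image \<open>q\<close> and kernel \<open>q\<close> make the monodromy nilpotent, but its trace is \<open>b \<noteq> 0\<close>.\<close>
    have im: "br (mono_up x s *v w) q = 0" for w
    proof -
      have "step x s *v w = (br w p / br q p) *s q" for w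
        using pq qp by (simp add: step_def rt_def x edge_mat_mult_vec flip: p_def q_def)
          (simp add: vec_eq_iff forall_2, simp add: field_simps br_def)
      then show ?thesis by (simp add: R br_def flip: matrix_vector_mul_assoc)
    qed
    have ker: "mono_up x s *v v = 0" using mono_up_eigvec[OF s, of x] a by (simp add: v_def)
    have tr: "mono_up x s $ 1 $ 1 + mono_up x s $ 2 $ 2 \<noteq> 0"
      using trace_mono_up[OF s, of x] a b by (simp add: trace_def sum_2)
    \<comment> \<open>For this \<open>x\<close> the kernel of \<open>step_rev\<close> is the line of
      \<open>q\<close>.\<close>
    obtain t where t: "v = t *s q" "t \<noteq> 0"
    proof -
      have "v = (br v p / br q p) *s q"
        using 0 by (simp add: eigvec_Suc step_rev_def x edge_mat_mult_vec v_def p_def q_def vec_eq_iff)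
      moreover have "v \<noteq> 0" using \<open>eigvec x s \<noteq> 0\<close> by (simp add: v_def)
      ultimately show thesis by (metis that vector_smult_lzero)
    qed
    define M where "M = mono_up x s"
    have "M *v q = 0" using ker t by (simp add: vector_scalar_commute M_def)
    then have "M $ 1 $ 1 * q $ 1 + M $ 1 $ 2 * q $ 2 = 0" "M $ 2 $ 1 * q $ 1 + M $ 2 $ 2 * q $ 2 = 0"
      by (simp_all add: mat2)
    moreover have "M $ 1 $ 1 * q $ 2 = q $ 1 * M $ 2 $ 1" "M $ 1 $ 2 * q $ 2 = q $ 1 * M $ 2 $ 2"
      using im[of "vector [1, 0]"] im[of "vector [0, 1]"] by (simp_all add: br_def mat2 M_def)
    \<comment> \<open>A matrix with image in the line of \<open>q\<close> maps \<open>q\<close> to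
      its trace times \<open>q\<close>.\<close>
    ultimately have "q $ 1 * (M $ 1 $ 1 + M $ 2 $ 2) = 0" "q $ 2 * (M $ 1 $ 1 + M $ 2 $ 2) = 0"
      by algebra+
    then have "q $ 1 = 0" "q $ 2 = 0" using tr by (simp_all add: M_def)
    then show False using pq by (simp add: br_def)
  qed
qed

text \<open>Up to sign, the linear coefficient of the lower left entry is the denominator of the
  claim.\<close>

lemma derivative_base_mono:
  "((\<lambda>x. base_mono x n $ 2 $ 1) has_field_derivative
     - (\<Sum>l<n. slope l * (\<alpha> (int l) - \<beta> (- int l - 1)))) (at 0)"
proof (induction n)
  case 0
  show ?case by (simp add: base_mono_0 mat_def)
next
  case (Suc n)
  have "((\<lambda>x. base_mono x n $ 2 $ 1 * (1 + x * \<beta> (- int n - 1))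
     + ev_\<alpha> x n * (x * slope n * (\<beta> (- int n - 1) - \<alpha> (int n)))) has_field_derivative
     - (\<Sum>l<n. slope l * (\<alpha> (int l) - \<beta> (- int l - 1))) + slope n * (\<beta> (- int n - 1) - \<alpha> (int n))) (at 0)"
    unfolding ev_\<alpha>_def
    by (rule derivative_eq_intros Suc derivative_prod_linear refl)+ (simp add: base_mono_at_0)
  then show ?case by (simp add: base_mono_Suc base_mono_entries algebra_simps)
qed

section \<open>Values at 0 and degree bounds\<close>

lemma step_0: "step 0 s = mat 1"
  by (simp add: step_def rt_def edge_mat_def mat_def vec_eq_iff)

lemma line_0: "line 0 s = mat 1"
  by (induction s) (simp_all add: line_def step_0)

lemma mat_deg_le_line_rev: "mat_deg_le s (\<lambda>x. line_rev x s)"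
proof (induction s)
  case (Suc s)
  have "mat_deg_le 1 (\<lambda>x. step_rev x s)" unfolding step_rev_def by (rule mat_deg_le_edge)
  from mat_deg_le_mult[OF this Suc] show ?case by simp
qed (simp add: mat_deg_le_const)

lemma mat_deg_le_mono_dn: "mat_deg_le (m * 2) (\<lambda>x. mono_dn x s)"
  unfolding mono_dn_def
proof (rule mat_deg_le_mprod)
  fix l
  have "mat_deg_le (1 + 1) (\<lambda>x. dn x s (int s + int l + 1) ** rt x s (int s + int l + 1))"
    unfolding dn_def rt_def by (rule mat_deg_le_mult[OF mat_deg_le_edge mat_deg_le_edge])
  then show "mat_deg_le 2 (\<lambda>x. dn x s (int s + int l + 1) ** rt x s (int s + int l + 1))"
    by (simp add: numeral_2_eq_2)
qed

lemma mat_deg_le_base_mono: "mat_deg_le n (\<lambda>x. base_mono x n)"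
proof -
  have "mat_deg_le (n * 1) (\<lambda>x. base_mono x n)"
    unfolding base_mono_def
  proof (rule mat_deg_le_mprod)
    fix l
    show "mat_deg_le 1 (\<lambda>x. rt x 0 (int l) ** dn x 0 (int l + 1))"
      unfolding rt_def dn_def by (rule mat_deg_le_two_edges)
  qed
  then show ?thesis by simp
qed

lemma mat_deg_le_line_even: "mat_deg_le k (\<lambda>x. line x (2 * k))"
proof (induction k)
  case (Suc k)
  have "mat_deg_le 1 (\<lambda>x. step x (2 * k) ** step x (Suc (2 * k)))"
    unfolding step_def rt_def using mat_deg_le_two_edges[of _ "X (2 * k) (int (2 * k))"]
    by (simp add: add.commute)
  from mat_deg_le_mult[OF Suc this] show ?case by (simp add: line_def matrix_mul_assoc)
qed (simp add: line_def mat_deg_le_const)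

text \<open>The claim at the vertex \<open>(2 * m - 1, 0)\<close>, cross-multiplied so that a point
  at infinity is included.\<close>

lemma top_level_slope:
  "X (2 * m - 1) (int (2 * m - 1)) $ 1 * (\<Sum>l<m. slope l * (\<alpha> (int l) - \<beta> (- int l - 1)))
     = X (2 * m - 1) (int (2 * m - 1)) $ 2 * (\<Sum>l<m. \<alpha> (int l) - \<beta> (- int l - 1))"
proof -
  define n where "n = 2 * (m - 1)"
  have N: "2 * m - 1 = Suc n" and n: "n < 2 * m - 1" using m_pos by (auto simp: n_def)
  define y where "y = X (Suc n) (int (Suc n))"
  define g where "g x = line x (Suc n) *v y" for x
  \<comment> \<open>The second component of
    \<open>mono_up x 0 *v g x - ev_\<beta> x m *s g x\<close>; the first is 0 by
    triangularity.\<close>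
  define f where "f x = base_mono x m $ 2 $ 1 * g x $ 1 + (ev_\<alpha> x m - ev_\<beta> x m) * g x $ 2" for x
  \<comment> \<open>The last projection kills \<open>y\<close>, so only \<open>2 * m - 2\<close>
    edges contribute; taken in pairs they give degree \<open>m - 1\<close>.\<close>
  have "step x n *v y = y" for x
    by (simp add: step_def rt_def edge_mat_mult_vec y_def br_def add.commute)
  then have "g x = line x n *v y" for x
    by (simp add: g_def line_def flip: matrix_vector_mul_assoc)
  then have g_deg: "poly_deg_le (m - 1) (\<lambda>x. g x $ i)" for i
    using mat_deg_le_mult_vec[OF mat_deg_le_line_even[of "m - 1"]] by (simp add: n_def)
  have base_deg: "poly_deg_le m (\<lambda>x. base_mono x m $ i $ j)" for i j
    using mat_deg_le_base_mono by (simp add: mat_deg_le_def)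
  have f_deg: "poly_deg_le (Suc n) f"
  proof -
    have "poly_deg_le (m + (m - 1)) f"
      unfolding f_def base_mono_entries(1,3)[symmetric]
      by (intro poly_deg_le_add poly_deg_le_mult poly_deg_le_diff base_deg g_deg)
    \<comment> \<open>The degree bound is exactly the number of edges of the line, as the rigidity
      lemma requires.\<close>
    moreover have "m + (m - 1) = Suc n" using m_pos by (simp add: n_def)
    ultimately show ?thesis by (simp only:)
  qed
  have f_0: "f 0 = 0"
    by (simp add: f_def base_mono_at_0 ev_\<alpha>_def ev_\<beta>_def)
  \<comment> \<open>The same difference formed at the top vertex; it is the polynomial cofactor in
    \<open>key\<close>.\<close>
  define w where "w x i = (mono_dn x n *v y) $ i - ev_\<beta> x m * y $ i" for x i
  have w_deg: "poly_deg_le (m * 2) (\<lambda>x. w x i)" for i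
  proof -
    have "poly_deg_le (m * 2) (\<lambda>x. ev_\<beta> x m * y $ i)"
      using poly_deg_le_mult[OF base_deg[of 1 1] poly_deg_le_const[of m "y $ i"]]
      by (simp add: base_mono_entries mult_2_right)
    then show ?thesis unfolding w_def
      by (intro poly_deg_le_diff mat_deg_le_mult_vec mat_deg_le_mono_dn)
  qed
  have key: "eigvec x (Suc n) $ i * f x = (\<Prod>s<Suc n. 1 + x * \<alpha> (int s)) * w x i" for x i
  proof -
    have "line x (Suc n) *v (mono_dn x n *v y) = mono_up x 0 *v g x"
      using line_intertwines[OF n, of x] by (simp add: g_def matrix_vector_mul_assoc)
    also have "\<dots> = ev_\<beta> x m *s g x + f x *s vector [0, 1]"
      unfolding mono_up_0 by (simp add: mat2 base_mono_entries f_def algebra_simps)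
    finally have "line_rev x (Suc n) *v (line x (Suc n) *v (mono_dn x n *v y))
        = ev_\<beta> x m *s (line_rev x (Suc n) *v (line x (Suc n) *v y)) + f x *s eigvec x (Suc n)"
      unfolding eigvec_def g_def by (simp add: matrix_vector_right_distrib vector_scalar_commute)
    moreover define P where "P = (\<Prod>s<Suc n. 1 + x * \<alpha> (int s))"
    have "line_rev x (Suc n) *v (line x (Suc n) *v u) = P *s u" for u
      using line_rev_mult[of "Suc n" x] unfolding matrix_vector_mul_assoc P_def N
      by (simp only: mat_mult_scalar(3) order_refl simp_thms)
    ultimately have "P *s (mono_dn x n *v y) = ev_\<beta> x m *s (P *s y) + f x *s eigvec x (Suc n)"
      by (simp only:)
    then have "P * (mono_dn x n *v y) $ i = ev_\<beta> x m * (P * y $ i) + f x * eigvec x (Suc n) $ i"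
      unfolding vec_eq_iff by simp
    then have "eigvec x (Suc n) $ i * f x = P * w x i"
      unfolding w_def by (simp add: right_diff_distrib mult_ac)
    then show ?thesis unfolding P_def .
  qed
  have "f x = 0" for x
  proof (rule poly_prod_linear_rigid[OF f_deg f_0])
    show "poly_deg_le (Suc n) (\<lambda>x. eigvec x (Suc n) $ 1)" "poly_deg_le (Suc n) (\<lambda>x. eigvec x (Suc n) $ 2)"
      unfolding eigvec_def by (intro mat_deg_le_mult_vec mat_deg_le_line_rev)+
    show "\<not> (eigvec x (Suc n) $ 1 = 0 \<and> eigvec x (Suc n) $ 2 = 0)" for x
      using eigvec_nonzero[of "Suc n" x] N by (simp add: vec_eq_iff forall_2)
    show "poly_deg_le (m * 2) (\<lambda>x. w x 1)" "poly_deg_le (m * 2) (\<lambda>x. w x 2)"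
      by (rule w_deg)+
    show "eigvec x (Suc n) $ 1 * f x = (\<Prod>s<Suc n. 1 + x * \<alpha> (int s)) * w x 1"
      "eigvec x (Suc n) $ 2 * f x = (\<Prod>s<Suc n. 1 + x * \<alpha> (int s)) * w x 2" for x
      by (rule key)+
    show "\<alpha> (int s) \<noteq> 0" for s by (rule \<alpha>_nz)
  qed
  then have f_eq: "f = (\<lambda>x. 0)" by auto
  \<comment> \<open>Both coefficients of \<open>g\<close> in \<open>f\<close> vanish at 0, so
    \<open>g1\<close> and \<open>g2\<close> drop out of the derivative of \<open>f\<close>.\<close>
  obtain g1 g2 where g': "((\<lambda>x. g x $ 1) has_field_derivative g1) (at 0)" "((\<lambda>x. g x $ 2) has_field_derivative g2) (at 0)"
    using poly_deg_le_deriv g_deg by metis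
  have g0: "g 0 = y" by (simp add: g_def line_0)
  have "(f has_field_derivative
      - (\<Sum>l<m. slope l * (\<alpha> (int l) - \<beta> (- int l - 1))) * y $ 1
      + ((\<Sum>l<m. \<alpha> (int l)) - (\<Sum>l<m. \<beta> (- int l - 1))) * y $ 2) (at 0)"
    unfolding f_def ev_\<alpha>_def ev_\<beta>_def
    by (rule derivative_eq_intros g' derivative_base_mono derivative_prod_linear refl)+ (simp add: g0 base_mono_at_0)
  moreover have "(f has_field_derivative 0) (at 0)" unfolding f_eq by simp
  ultimately have "- (\<Sum>l<m. slope l * (\<alpha> (int l) - \<beta> (- int l - 1))) * y $ 1
      + ((\<Sum>l<m. \<alpha> (int l)) - (\<Sum>l<m. \<beta> (- int l - 1))) * y $ 2 = 0"
    by (rule DERIV_unique)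
  then show ?thesis unfolding N y_def[symmetric] sum_subtractf by (simp add: algebra_simps)
qed

end


section \<open>Perturbation of the labels\<close>

text \<open>The fourth point of a quad is linear in homogeneous coordinates, which makes the propagated
  rows depend polynomially on the labels.\<close>

fun propagate :: "(int \<Rightarrow> complex) \<Rightarrow> (int \<Rightarrow> complex) \<Rightarrow> (int \<Rightarrow> complex^2) \<Rightarrow> nat \<Rightarrow> int \<Rightarrow> complex^2" where
  "propagate \<alpha> \<beta> y 0 i = vector [0, 1]"
| "propagate \<alpha> \<beta> y (Suc 0) i = y i"
| "propagate \<alpha> \<beta> y (Suc (Suc k)) i =
     (\<beta> (int k - (i - 1)) * br (propagate \<alpha> \<beta> y k (i - 1)) (propagate \<alpha> \<beta> y (Suc k) i))
       *s propagate \<alpha> \<beta> y (Suc k) (i - 1)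
   + (\<alpha> (i - 1) * br (propagate \<alpha> \<beta> y (Suc k) (i - 1)) (propagate \<alpha> \<beta> y k (i - 1)))
       *s propagate \<alpha> \<beta> y (Suc k) i"

text \<open>In the cross-ratio of \<open>a\<close>, \<open>b\<close>, \<open>c\<close>,
  \<open>d\<close> the factor \<open>br b d\<close> cancels and leaves \<open>p / q\<close>. The
  identities involve no division, so they hold for all perturbed rows.\<close>

lemma fourth_point_brackets:
  fixes a b d :: "complex^2" and p q :: complex
  defines "c \<equiv> (q * br a b) *s d + (p * br d a) *s b"
  shows "br b c = q * br a b * br b d" and "br c d = p * br d a * br b d"
  by (simp_all add: c_def br_def algebra_simps)

section \<open>Points of the sphere as homogeneous vectors\<close>

definition hvec :: "rsphere \<Rightarrow> complex^2" where
  "hvec p = vector [fst (hom_coord p), snd (hom_coord p)]"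

lemma br_hvec: "br (hvec p) (hvec q) = bracket p q"
  by (simp add: br_def hvec_def bracket_def)

lemma bracket_eq_0_iff: "bracket p q = 0 \<longleftrightarrow> p = q"
  by (cases p; cases q) (auto simp: bracket_def)

lemma hvec_nonzero: "hvec p \<noteq> 0"
  by (cases p) (auto simp: hvec_def vec_eq_iff forall_2)

lemma br_scale: "br (s *s u) (t *s v) = s * t * br u v"
  by (simp add: br_def algebra_simps)

lemma br_eq_0_imp_parallel:
  assumes "br u v = 0" "u \<noteq> 0" "v \<noteq> 0"
  obtains t where "t \<noteq> 0" "v = t *s u"
proof (cases "u $ 1 = 0")
  case True
  then have "u $ 2 \<noteq> 0" using assms(2) by (auto simp: vec_eq_iff forall_2)
  then have "v = (v $ 2 / u $ 2) *s u"
    using assms(1) True by (auto simp: br_def vec_eq_iff forall_2)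
  with that assms(3) show thesis by (metis vector_smult_lzero)
next
  case False
  then have "v = (v $ 1 / u $ 1) *s u"
    using assms(1) by (auto simp: br_def vec_eq_iff forall_2 field_simps)
  with that assms(3) show thesis by (metis vector_smult_lzero)
qed

text \<open>For \<open>b = d\<close> the cross-ratio is 1 for every third point other than
  \<open>b\<close>, which contradicts uniqueness. Distinctness keeps the fourth-point vector from
  being zero.\<close>

lemma fourth_point_unique_imp_distinct:
  assumes uniq: "\<exists>!c. cr a b c d = q" and nz: "q \<noteq> 0"
  shows "b \<noteq> d"
proof
  assume d: "b = d"
  obtain c where c: "cr a b c d = q" using uniq by blast
  have one: "cr a b e d = 1" if "a \<noteq> b" "e \<noteq> b" for e
  proof -
    have "bracket a b \<noteq> 0" "bracket b e \<noteq> 0" using that by (auto simp: bracket_eq_0_iff)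
    moreover have "bracket e b = - bracket b e" "bracket b a = - bracket a b"
      by (simp_all add: bracket_def)
    ultimately show ?thesis by (simp add: cr_def flip: d)
  qed
  have ab: "a \<noteq> b" "c \<noteq> b" using c nz d by (auto simp: cr_def bracket_eq_0_iff)
  then have "q = 1" using one c by simp
  obtain e where "e \<noteq> b" "e \<noteq> c" 
  proof -
    have "card {b, c} \<le> 2" by (cases "b = c") auto
    moreover have "card {Fin 0, Fin 1, Infty} = 3" by simp
    ultimately have "\<not> {Fin 0, Fin 1, Infty} \<subseteq> {b, c}"
      using card_mono[of "{b, c}" "{Fin 0, Fin 1, Infty}"] by fastforce
    then show thesis using that by blast
  qed
  then show False using one[OF ab(1)] uniq c \<open>q = 1\<close> by metis
qed

section \<open>Periodic sequences and their sums\<close>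

lemma periodic_mult:
  fixes f :: "int \<Rightarrow> 'a"
  assumes "\<And>i. f (i + int m) = f i"
  shows "f (i + c * int m) = f i"
proof (induction c rule: int_induct[of _ 0])
  case (step1 c)
  then show ?case using assms[of "i + c * int m"] by (simp add: algebra_simps)
next
  case (step2 c)
  then show ?case using assms[of "i + (c - 1) * int m"] by (simp add: algebra_simps)
qed simp

lemma periodic_mod:
  fixes f :: "int \<Rightarrow> 'a"
  assumes "\<And>i. f (i + int m) = f i"
  shows "f i = f (i mod int m)"
  using periodic_mult[of f m "i mod int m" "i div int m", OF assms]
  by (simp add: mult.commute)

lemma sum_periodic_shift:
  fixes f :: "int \<Rightarrow> 'a::ab_group_add"
  assumes "\<And>i. f (i + int m) = f i"
  shows "(\<Sum>l<m. f (int l + c)) = (\<Sum>l<m. f (int l))"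
proof -
  have step: "(\<Sum>l<m. f (int l + (c + 1))) = (\<Sum>l<m. f (int l + c))" for c
  proof -
    have "(\<Sum>l<m. f (int l + (c + 1))) = (\<Sum>l<m. f (int (Suc l) + c))"
      by (simp add: algebra_simps)
    also have "\<dots> = (\<Sum>l<m. f (int l + c)) + f (int m + c) - f (int 0 + c)"
      using sum.lessThan_Suc_shift[of "\<lambda>l. f (int l + c)" m] by (simp add: algebra_simps)
    finally show ?thesis using assms[of c] by (simp add: add.commute)
  qed
  show ?thesis
  proof (induction c rule: int_induct[of _ 0])
    case (step1 c)
    then show ?case using step[of c] by simp
  next
    case (step2 c)
    then show ?case using step[of "c - 1"] by simp
  qed simp
qed

text \<open>Meant for the \<beta>-labels, whose indices decrease along a zigzag.\<close>

lemma sum_periodic_reflect: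
  fixes f :: "int \<Rightarrow> 'a::ab_group_add"
  assumes "\<And>i. f (i + int m) = f i"
  shows "(\<Sum>l<m. f (c - int l)) = (\<Sum>l<m. f (int l))"
proof -
  have "(\<Sum>l<m. f (c - int l)) = (\<Sum>l<m. f (c - int (m - Suc l)))"
    by (rule sum.nat_diff_reindex[symmetric])
  also have "\<dots> = (\<Sum>l<m. f (int l + (c + 1 - int m)))"
    by (intro sum.cong) (auto simp: of_nat_diff algebra_simps)
  also have "\<dots> = (\<Sum>l<m. f (int l))" by (rule sum_periodic_shift) (rule assms)
  finally show ?thesis .
qed

lemma propagate_periodic:
  assumes "\<And>i. \<alpha> (i + int m) = \<alpha> i" "\<And>i. \<beta> (i + int m) = \<beta> i" "\<And>i. y (i + int m) = y i"
  shows "propagate \<alpha> \<beta> y k (i + int m) = propagate \<alpha> \<beta> y k i"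
proof (induction k arbitrary: i rule: less_induct)
  case (less k)
  consider "k = 0" | "k = 1" | n where "k = Suc (Suc n)" by (metis One_nat_def not0_implies_Suc)
  then show ?case
  proof cases
    case (3 n)
    have "\<alpha> (i + int m - 1) = \<alpha> (i - 1)" using assms(1)[of "i - 1"] by (simp add: algebra_simps)
    moreover have "\<beta> (int n - (i + int m - 1)) = \<beta> (int n - (i - 1))"
      using assms(2)[of "int n - (i + int m - 1)"] by (simp add: algebra_simps)
    moreover have "propagate \<alpha> \<beta> y l (i + int m - 1) = propagate \<alpha> \<beta> y l (i - 1)" if "l < k" for l
      using less[OF that, of "i - 1"] by (simp add: algebra_simps)
    moreover have "propagate \<alpha> \<beta> y (Suc n) (i + int m) = propagate \<alpha> \<beta> y (Suc n) i"
      using less[of "Suc n" i] 3 by simp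
    ultimately show ?thesis using 3 by simp
  qed (simp_all add: assms)
qed

lemma propagate_continuous:
  "isCont (\<lambda>e. propagate (\<lambda>i. \<alpha> i + e) \<beta> y k i $ j) e"
proof (induction k arbitrary: i j rule: less_induct)
  case (less k)
  consider "k = 0" | "k = 1" | n where "k = Suc (Suc n)" by (metis One_nat_def not0_implies_Suc)
  then show ?case
  proof cases
    case (3 n)
    have IH: "isCont (\<lambda>e. propagate (\<lambda>i. \<alpha> i + e) \<beta> y n i $ j) e"
      "isCont (\<lambda>e. propagate (\<lambda>i. \<alpha> i + e) \<beta> y (Suc n) i $ j) e" for i j
      by (rule less, simp add: 3)+
    show ?thesis unfolding 3 propagate.simps br_def vector_add_component vector_smult_component
      by (intro continuous_intros IH)
  qed auto
qed

text \<open>\<open>Z k i\<close> is the point at the vertex \<open>(i, k - i)\<close>;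
  \<open>Suc k < 2 * m - 1\<close> admits the quads with top level at most \<open>2 * m - 1\<close>.
  Labels \<alpha> and \<beta> may coincide here.\<close>

locale cr_sphere =
  fixes m :: nat and \<alpha> \<beta> :: "int \<Rightarrow> complex" and Z :: "nat \<Rightarrow> int \<Rightarrow> rsphere"
  assumes m_pos: "m \<ge> 1"
    and per: "\<And>i. \<alpha> (i + int m) = \<alpha> i" "\<And>i. \<beta> (i + int m) = \<beta> i" "\<And>i. Z 1 (i + int m) = Z 1 i"
    and nz: "\<And>i. \<alpha> i \<noteq> 0" "\<And>i. \<beta> i \<noteq> 0"
    and level0: "\<And>i. Z 0 i = Fin 0"
    and level1: "\<And>i. Z 1 i \<noteq> Fin 0"
    and cross: "\<And>k i. Suc k < 2 * m - 1 \<Longrightarrow>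
        cr (Z k i) (Z (Suc k) (i + 1)) (Z (Suc (Suc k)) (i + 1)) (Z (Suc k) i) = \<alpha> i / \<beta> (int k - i)"
    and uniq: "\<And>k i. Suc k < 2 * m - 1 \<Longrightarrow>
        \<exists>!c. cr (Z k i) (Z (Suc k) (i + 1)) c (Z (Suc k) i) = \<alpha> i / \<beta> (int k - i)"
begin

section \<open>Propagation with perturbed labels\<close>

definition V :: "complex \<Rightarrow> nat \<Rightarrow> int \<Rightarrow> complex^2" where
  "V e = propagate (\<lambda>i. \<alpha> i + e) \<beta> (\<lambda>i. hvec (Z 1 i))"

lemma V_level0: "V e 0 i = vector [0, 1]" and V_level1: "V e (Suc 0) i = hvec (Z 1 i)"
  by (simp_all add: V_def)

lemma V_step:
  "V e (Suc (Suc k)) (i + 1) =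
     (\<beta> (int k - i) * br (V e k i) (V e (Suc k) (i + 1))) *s V e (Suc k) i
   + ((\<alpha> i + e) * br (V e (Suc k) i) (V e k i)) *s V e (Suc k) (i + 1)"
  by (simp add: V_def)

text \<open>In each quad the fourth-point vector is nonzero, and by the cross-ratio relation it is
  parallel to the given fourth point.\<close>

lemma V_represents:
  "k \<le> 2 * m - 1 \<Longrightarrow> \<exists>t. t \<noteq> 0 \<and> V 0 k i = t *s hvec (Z k i)"
proof (induction k arbitrary: i rule: less_induct)
  case (less k)
  consider "k = 0" | "k = 1" | n where "k = Suc (Suc n)" by (metis One_nat_def not0_implies_Suc)
  then show ?case
  proof cases
    case 1
    then show ?thesis by (intro exI[of _ 1]) (simp add: V_level0 level0 hvec_def vec_eq_iff)
  next
    case 2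
    then show ?thesis by (intro exI[of _ 1]) (simp add: V_level1 vec_eq_iff)
  next
    case (3 n)
    define h where "h = i - 1"
    have i: "i = h + 1" by (simp add: h_def)
    have n: "Suc n < 2 * m - 1" using less.prems 3 by simp
    obtain ta tb td where t: "ta \<noteq> 0" "V 0 n h = ta *s hvec (Z n h)"
      "tb \<noteq> 0" "V 0 (Suc n) (h + 1) = tb *s hvec (Z (Suc n) (h + 1))"
      "td \<noteq> 0" "V 0 (Suc n) h = td *s hvec (Z (Suc n) h)"
      using less.IH[of n h] less.IH[of "Suc n" "h + 1"] less.IH[of "Suc n" h] less.prems 3 by auto
    define a b c d where "a = Z n h" and "b = Z (Suc n) (h + 1)" and "c = Z (Suc (Suc n)) (h + 1)" and "d = Z (Suc n) h"
    note abcd = a_def[symmetric] b_def[symmetric] c_def[symmetric] d_def[symmetric]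
    have cr: "cr a b c d = \<alpha> h / \<beta> (int n - h)" using cross[OF n, of h] by (simp add: abcd)
    then have nzb: "bracket a b \<noteq> 0" "bracket c d \<noteq> 0" "bracket b c \<noteq> 0" "bracket d a \<noteq> 0"
      using nz[of h] nz[of "int n - h"] by (auto simp: cr_def)
    have eq: "\<beta> (int n - h) * (bracket a b * bracket c d) = \<alpha> h * (bracket b c * bracket d a)"
      using cr nzb nz[of "int n - h"] by (simp add: cr_def field_simps)
    \<comment> \<open>Applicability of the propagation enters here and excludes the zero
      vector.\<close>
    have bd: "bracket b d \<noteq> 0"
      using fourth_point_unique_imp_distinct[OF uniq[OF n, of h]] nz
      by (simp add: abcd bracket_eq_0_iff)
    let ?c = "V 0 (Suc (Suc n)) (h + 1)"
    have c: "?c = (ta * tb * td) *s ((\<beta> (int n - h) * bracket a b) *s hvec d + (\<alpha> h * bracket d a) *s hvec b)"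
      unfolding V_step t abcd br_scale br_hvec by (simp add: vec_eq_iff algebra_simps)
    have "br (hvec b) ?c = ta * tb * td * (\<beta> (int n - h) * bracket a b * bracket b d)"
      unfolding c using fourth_point_brackets(1)[of "hvec b" "\<beta> (int n - h)" "hvec a" "hvec d" "\<alpha> h"]
        br_scale[of 1 "hvec b"] by (simp add: br_hvec)
    then have "?c \<noteq> 0" using t nzb bd nz by (auto simp: br_def)
    moreover have "br (hvec c) ?c = 0"
    proof -
      have "br (hvec c) ?c = ta * tb * td * (\<beta> (int n - h) * bracket a b * bracket c d
          + \<alpha> h * bracket d a * bracket c b)"
        unfolding c br_hvec[symmetric] by (simp add: br_def algebra_simps)
      moreover have "bracket c b = - bracket b c" by (simp add: bracket_def)
      ultimately show ?thesis using eq by (simp add: algebra_simps)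
    qed
    ultimately show ?thesis
      using br_eq_0_imp_parallel[of "hvec c" ?c] hvec_nonzero 3 i by (metis c_def)
  qed
qed

text \<open>Above level 0 these edges are upper sides of quads. A vanishing bracket, even in the
  denominator, would make the nonzero cross-ratio 0.\<close>

lemma edges_distinct:
  assumes "k < 2 * m - 1"
  shows "Z k i \<noteq> Z (Suc k) (i + 1)" and "Z k i \<noteq> Z (Suc k) i"
proof -
  have "Z k i \<noteq> Z (Suc k) (i + 1) \<and> Z k i \<noteq> Z (Suc k) i"
  proof (cases k)
    case 0
    then show ?thesis using level1[of i] level1[of "i + 1"] by (auto simp: level0)
  next
    case (Suc n)
    have ne: "cr (Z n h) (Z (Suc n) (h + 1)) (Z (Suc (Suc n)) (h + 1)) (Z (Suc n) h) \<noteq> 0" for h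
      using cross[of n h] assms Suc nz by simp
    show ?thesis using ne[of i] ne[of "i - 1"] Suc by (auto simp: cr_def bracket_eq_0_iff)
  qed
  then show "Z k i \<noteq> Z (Suc k) (i + 1)" and "Z k i \<noteq> Z (Suc k) i" by auto
qed

lemma V_periodic: "V e k (i + int m) = V e k i"
  unfolding V_def by (rule propagate_periodic) (simp_all add: per per(3)[unfolded One_nat_def])

lemma V_continuous: "isCont (\<lambda>e. V e k i $ j) e"
  unfolding V_def by (rule propagate_continuous)

lemma eventually_nondegenerate:
  assumes "k < 2 * m - 1"
  shows "\<forall>\<^sub>F e in at 0. br (V e k i) (V e (Suc k) (i + 1)) \<noteq> 0"
    and "\<forall>\<^sub>F e in at 0. br (V e k i) (V e (Suc k) i) \<noteq> 0"
proof -
  have *: "\<forall>\<^sub>F e in at 0. br (V e k i) (V e (Suc k) j) \<noteq> 0" if "Z k i \<noteq> Z (Suc k) j" for j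
  proof -
    have "isCont (\<lambda>e. br (V e k i) (V e (Suc k) j)) 0"
      unfolding br_def by (intro continuous_intros V_continuous)
    moreover have "br (V 0 k i) (V 0 (Suc k) j) \<noteq> 0"
      using V_represents[of k i] V_represents[of "Suc k" j] assms that
      by (auto simp: br_scale br_hvec bracket_eq_0_iff)
    ultimately show ?thesis
      by (auto simp: isCont_def intro: tendsto_imp_eventually_ne)
  qed
  show "\<forall>\<^sub>F e in at 0. br (V e k i) (V e (Suc k) (i + 1)) \<noteq> 0"
    and "\<forall>\<^sub>F e in at 0. br (V e k i) (V e (Suc k) i) \<noteq> 0"
    using edges_distinct[OF assms] by (auto intro!: *)
qed

text \<open>Periodicity reduces infinitely many conditions to finitely many residues.\<close>

lemma eventually_all_periodic:
  assumes "\<And>i. \<forall>\<^sub>F e in F. P e i" "\<And>e i. P e (i + int m) = P e i"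
  shows "\<forall>\<^sub>F e in F. \<forall>i. P e i"
proof -
  have "\<forall>\<^sub>F e in F. \<forall>i\<in>{0..<int m}. P e i"
    using assms(1) by (intro eventually_ball_finite) auto
  then show ?thesis
  proof eventually_elim
    case (elim e)
    have "P e i = P e (i mod int m)" for i by (rule periodic_mod) (rule assms(2))
    moreover have "i mod int m \<in> {0..<int m}" for i using m_pos by simp
    ultimately show ?case using elim by blast
  qed
qed

text \<open>Each forbidden coincidence of labels excludes one value of \<open>e\<close>, and
  nondegeneracy is an open condition.\<close>

lemma eventually_cr_lattice: "\<forall>\<^sub>F e in at 0. cr_lattice m (\<lambda>i. \<alpha> i + e) \<beta> (V e)"
proof -
  have right: "\<forall>\<^sub>F e in at 0. \<forall>k\<in>{..<2 * m - 1}. \<forall>i. br (V e k i) (V e (Suc k) (i + 1)) \<noteq> 0"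
  proof (intro eventually_ball_finite finite_lessThan ballI eventually_all_periodic eventually_nondegenerate)
    fix k e i
    show "(br (V e k (i + int m)) (V e (Suc k) (i + int m + 1)) \<noteq> 0) = (br (V e k i) (V e (Suc k) (i + 1)) \<noteq> 0)"
      using V_periodic[of e "Suc k" "i + 1"] by (simp add: V_periodic add_ac)
  qed simp
  have up: "\<forall>\<^sub>F e in at 0. \<forall>k\<in>{..<2 * m - 1}. \<forall>i. br (V e k i) (V e (Suc k) i) \<noteq> 0"
    by (intro eventually_ball_finite finite_lessThan ballI eventually_all_periodic eventually_nondegenerate)
      (simp_all add: V_periodic)
  have ne: "\<forall>\<^sub>F e in at 0. \<alpha> i + e \<noteq> c" for i c
  proof -
    have "\<forall>\<^sub>F e in at (0::complex). e \<noteq> c - \<alpha> i" by (rule eventually_neq_at_within)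
    then show ?thesis by eventually_elim (auto simp: algebra_simps)
  qed
  have "\<forall>\<^sub>F e in at 0. \<forall>i. \<alpha> i + e \<noteq> 0"
    by (intro eventually_all_periodic ne) (simp add: per)
  moreover have "\<forall>\<^sub>F e in at 0. \<forall>j i. \<alpha> i + e \<noteq> \<beta> j"
    by (intro eventually_all_periodic ne) (simp_all add: per)
  ultimately show ?thesis using right up
  proof eventually_elim
    case (elim e)
    show ?case
    proof
      fix k i assume k: "Suc k < 2 * m - 1"
      show "\<beta> (int k - i) * (br (V e k i) (V e (Suc k) (i + 1)) * br (V e (Suc (Suc k)) (i + 1)) (V e (Suc k) i))
        = (\<alpha> i + e) * (br (V e (Suc k) (i + 1)) (V e (Suc (Suc k)) (i + 1)) * br (V e (Suc k) i) (V e k i))"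
        unfolding V_step fourth_point_brackets by (simp add: algebra_simps)
    qed (use elim m_pos in \<open>auto simp: per V_periodic V_level0\<close>)
  qed
qed

text \<open>The equation holds for all small nonzero \<open>e\<close> and extends to
  \<open>e = 0\<close> by continuity.\<close>

lemma sphere_top_level_slope:
  "fst (hom_coord (Z (2 * m - 1) (int (2 * m - 1))))
      * (\<Sum>l<m. recip (Z 1 (int l + 1)) * (\<alpha> (int l) - \<beta> (- int l - 1)))
   = snd (hom_coord (Z (2 * m - 1) (int (2 * m - 1)))) * (\<Sum>l<m. \<alpha> (int l) - \<beta> (- int l - 1))"
proof -
  define N where "N = 2 * m - 1"
  define F where "F e = V e N (int N) $ 1 * (\<Sum>l<m. recip (Z 1 (int l + 1)) * (\<alpha> (int l) + e - \<beta> (- int l - 1)))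
    - V e N (int N) $ 2 * (\<Sum>l<m. \<alpha> (int l) + e - \<beta> (- int l - 1))" for e
  \<comment> \<open>Level 1 does not move with \<open>e\<close>; at infinity both sides are
    0.\<close>
  have slope: "V e 1 i $ 2 / V e 1 i $ 1 = recip (Z 1 i)" for e i
    using level1[of i] by (cases "Z 1 i") (auto simp: V_level1 hvec_def)
  have "\<forall>\<^sub>F e in at 0. F e = 0"
    using eventually_cr_lattice
  proof eventually_elim
    case (elim e)
    interpret cr_lattice m "\<lambda>i. \<alpha> i + e" \<beta> "V e" by (rule elim)
    show ?case using top_level_slope unfolding slope_def slope F_def N_def by simp
  qed
  then have "(F \<longlongrightarrow> 0) (at 0)" by (rule tendsto_eventually)
  moreover have "isCont F 0" unfolding F_def by (intro continuous_intros V_continuous)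
  then have "(F \<longlongrightarrow> F 0) (at 0)" by (simp add: isCont_def)
  ultimately have "F 0 = 0" using tendsto_unique[of "at (0::complex)" F] by simp
  moreover obtain t where "t \<noteq> 0" "V 0 N (int N) = t *s hvec (Z N (int N))"
    using V_represents[of N "int N"] by (auto simp: N_def)
  ultimately show ?thesis by (simp add: F_def hvec_def N_def mult.assoc flip: right_diff_distrib)
qed

end


section \<open>Dual monodromy and the theorem\<close>

text \<open>If level 0 is 0, this is the increment of a dual map from \<open>(t, - t)\<close>
  through \<open>(t + 1, - t)\<close> to \<open>(t + 1, - t - 1)\<close>.\<close>

definition row_one_term ::
    "(int \<Rightarrow> complex) \<Rightarrow> (int \<Rightarrow> complex) \<Rightarrow> (int \<Rightarrow> int \<Rightarrow> rsphere) \<Rightarrow> int \<Rightarrow> complex" where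
  "row_one_term \<alpha> \<beta> z t = recip (z (t + 1) (- t)) * (\<alpha> t - \<beta> (- t - 1))"

lemma row_one_term_periodic:
  assumes "m_closed n m \<alpha> \<beta> z"
  shows "row_one_term \<alpha> \<beta> z (t + int m) = row_one_term \<alpha> \<beta> z t"
proof -
  have "on_levels n (t + 1) (- t)" by (simp add: on_levels_def)
  then have "z (t + 1 + int m) (- t - int m) = z (t + 1) (- t)"
    using assms by (simp add: m_closed_def)
  moreover have "\<beta> (- t - int m - 1) = \<beta> (- t - 1)" "\<alpha> (t + int m) = \<alpha> t"
    using assms unfolding m_closed_def
    by (metis add.commute add_diff_cancel_left' diff_add_eq diff_diff_add uminus_add_conv_diff, metis)
  ultimately show ?thesis by (simp add: row_one_term_def add_ac)
qed

text \<open>The form takes the same value on an edge and on its translate by one period.\<close>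

lemma additive_monodromy_level_step:
  assumes "m_closed n m \<alpha> \<beta> z" "dual_map n \<alpha> \<beta> z zs"
    and "on_levels n k l" "on_levels n k (l + 1)"
  shows "additive_monodromy m zs k (l + 1) = additive_monodromy m zs k l"
proof -
  have per: "z (k + int m) (l - int m) = z k l" "z (k + int m) (l + 1 - int m) = z k (l + 1)"
    using assms(1,3,4) unfolding m_closed_def by blast+
  have shift: "l - int m + 1 = l + 1 - int m" by simp
  have \<beta>: "\<beta> (l - int m) = \<beta> l"
    using assms(1) unfolding m_closed_def by (metis diff_add_cancel)
  have "zs k l - zs k (l + 1) = \<beta> l * inv_diff (z k l) (z k (l + 1))"
    using assms(2-) unfolding dual_map_def by blast
  moreover have "zs (k + int m) (l - int m) - zs (k + int m) (l - int m + 1)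
      = \<beta> (l - int m) * inv_diff (z (k + int m) (l - int m)) (z (k + int m) (l - int m + 1))"
    using assms(2-) unfolding dual_map_def on_levels_def by simp
  ultimately show ?thesis unfolding additive_monodromy_def shift per \<beta> by (simp add: algebra_simps)
qed

lemma additive_monodromy_level_0:
  assumes "dual_map n \<alpha> \<beta> z zs" "\<And>i. z i (- i) = Fin 0"
  shows "additive_monodromy m zs k (- k) = (\<Sum>l<m. row_one_term \<alpha> \<beta> z (int l + k))"
proof -
  have inv: "inv_diff (Fin 0) w = - recip w" for w by (cases w) simp_all
  have step: "zs (i + 1) (- i - 1) - zs i (- i) = row_one_term \<alpha> \<beta> z i" for i
  proof -
    have "zs i (- i) - zs (i + 1) (- i) = \<alpha> i * inv_diff (z i (- i)) (z (i + 1) (- i))"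
      using assms(1) by (simp add: dual_map_def on_levels_def)
    moreover have "zs (i + 1) (- i - 1) - zs (i + 1) (- i)
        = \<beta> (- i - 1) * inv_diff (z (i + 1) (- i - 1)) (z (i + 1) (- i))"
      using assms(1)[unfolded dual_map_def on_levels_def, THEN conjunct2, rule_format, of "i + 1" "- i - 1"]
      by simp
    moreover have "z (i + 1) (- i - 1) = Fin 0" using assms(2)[of "i + 1"] by simp
    ultimately show ?thesis using assms(2)[of i]
      by (simp add: inv row_one_term_def algebra_simps)
  qed
  have "zs (k + int m) (- k - int m) - zs k (- k) = (\<Sum>l<m. row_one_term \<alpha> \<beta> z (int l + k))"
  proof (induction m)
    case (Suc m)
    then show ?case using step[of "k + int m"] by (simp add: algebra_simps)
  qed simp
  then show ?thesis by (simp add: additive_monodromy_def)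
qed

text \<open>Descending to level 0 with \<open>k\<close> fixed preserves the monodromy; there the sum
  over a full period does not depend on its start.\<close>

lemma additive_monodromy_eq:
  assumes "m_closed n m \<alpha> \<beta> z" "dual_map n \<alpha> \<beta> z zs" "\<And>i. z i (- i) = Fin 0" "on_levels n k l"
  shows "additive_monodromy m zs k l = (\<Sum>t<m. row_one_term \<alpha> \<beta> z (int t))"
proof -
  have "t \<le> n + 1 \<Longrightarrow> additive_monodromy m zs k (- k + int t) = additive_monodromy m zs k (- k)" for t
  proof (induction t)
    case (Suc t)
    have "additive_monodromy m zs k (- k + int t + 1) = additive_monodromy m zs k (- k + int t)"
      using assms(1,2) Suc.prems by (intro additive_monodromy_level_step) (auto simp: on_levels_def)
    with Suc show ?case by (simp add: add_ac)
  qed simp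
  from this[of "nat (k + l)"] have "additive_monodromy m zs k l = additive_monodromy m zs k (- k)"
    using assms(4) by (simp add: on_levels_def nat_le_iff)
  then show ?thesis
    using additive_monodromy_level_0[OF assms(2,3), of m k]
      sum_periodic_shift[of "row_one_term \<alpha> \<beta> z" m k] row_one_term_periodic[OF assms(1)] by simp
qed

lemma quot_eqI:
  assumes "fst (hom_coord p) * D = snd (hom_coord p) * S" "S \<noteq> 0 \<or> D \<noteq> 0"
  shows "p = quot S D"
  using assms by (cases p) (auto simp: quot_def field_simps)

text \<open>Here \<open>n\<close> counts propagations. The last two hypotheses express genericity:
  level 1 avoids the constant value 0, and the quotient is not \<open>0 / 0\<close>.\<close>

theorem theorem5p7:
  fixes m n :: nat
    and \<alpha> \<beta> :: "int \<Rightarrow> complex"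
    and z :: "int \<Rightarrow> int \<Rightarrow> rsphere"
    and S D :: complex
  defines "S \<equiv> \<Sum>l<m. \<alpha> (int l) - \<beta> (int l)"
    and "D \<equiv> \<Sum>l<m. recip (rot z (2 * int l + 1) 1) * (\<alpha> (int l) - \<beta> (- int l - 1))"
  assumes "m \<ge> 1"
    and "n \<ge> 2 * m - 2"
    and "integrable_cr_map n \<alpha> \<beta> z"
    and "m_closed n m \<alpha> \<beta> z"
    and "\<forall>i. even i \<longrightarrow> rot z i 0 = Fin 0"
    and "propagates n \<alpha> \<beta> z"
    and "\<forall>i. odd i \<longrightarrow> rot z i 1 \<noteq> Fin 0"
    and "S \<noteq> 0 \<or> D \<noteq> 0"
  shows "\<forall>i. odd i \<longrightarrow>
           rot z i (2 * int m - 1) = quot S D \<and>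
           (\<forall>zs k l. dual_map n \<alpha> \<beta> z zs \<and> on_levels n k l \<longrightarrow>
              rot z i (2 * int m - 1) = quot S (additive_monodromy m zs k l))"
proof (intro allI impI)
  note m = assms(3) and n = assms(4) and propag = assms(8)
  note integrable = assms(5) and closed = assms(6)
  fix i :: int assume i: "odd i"
  have z_level0: "z t (- t) = Fin 0" for t
    using assms(7)[rule_format, of "t - (- t)"] rot_coords[of z t "- t"] by simp
  have rot1: "rot z (2 * t + 1) 1 = z (t + 1) (- t)" for t
    using rot_coords[of z "t + 1" "- t"] by (simp add: algebra_simps)
  have z_level1: "z (t + 1) (- t) \<noteq> Fin 0" for t
    using assms(9)[rule_format, of "2 * t + 1"] by (simp add: rot1)
  have label_per: "\<alpha> (t + int m) = \<alpha> t" "\<beta> (t + int m) = \<beta> t" for t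
    using closed by (simp_all add: m_closed_def)
  have z_per: "z (t + int m) (s - int m) = z t s" if "on_levels n t s" for t s
    using closed that by (simp add: m_closed_def)
  \<comment> \<open>The second lattice coordinate of the target vertex; shifting by it moves the
    target to \<open>(2 * m - 1, 0)\<close>.\<close>
  define b where "b = (2 * int m - 1 - i) div 2"
  have ib: "(i + (2 * int m - 1)) div 2 = 2 * int m - 1 - b" using i by (auto simp: b_def elim!: oddE)
  define Z where "Z k p = z (p - b) (int k - p + b)" for k p
  have Z1: "Z 1 p = z (p - 1 - b + 1) (- (p - 1 - b))" for p by (simp add: Z_def algebra_simps)
  interpret cr_sphere m "\<lambda>t. \<alpha> (t - b)" "\<lambda>t. \<beta> (t + b)" Z
  proof
    show "\<alpha> (t + int m - b) = \<alpha> (t - b)" for t using label_per(1)[of "t - b"] by (simp add: algebra_simps)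
    show "\<beta> (t + int m + b) = \<beta> (t + b)" for t using label_per(2)[of "t + b"] by (simp add: algebra_simps)
    show "Z 1 (p + int m) = Z 1 p" for p
      using z_per[of "p - b" "1 - p + b"] by (simp add: Z_def on_levels_def algebra_simps)
    show "\<alpha> (t - b) \<noteq> 0" "\<beta> (t + b) \<noteq> 0" for t using integrable by (simp_all add: integrable_cr_map_def)
    show "Z 0 p = Fin 0" for p using z_level0[of "p - b"] by (simp add: Z_def)
    show "Z 1 p \<noteq> Fin 0" for p unfolding Z1 by (rule z_level1)
    fix k p assume k: "Suc k < 2 * m - 1"
    define P Q where "P = p - b" and "Q = int k - p + b"
    have PQ: "P + Q = int k" by (simp add: P_def Q_def)
    have Zs: "Z k p = z P Q" "Z (Suc k) (p + 1) = z (P + 1) Q"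
      "Z (Suc (Suc k)) (p + 1) = z (P + 1) (Q + 1)" "Z (Suc k) p = z P (Q + 1)"
      by (simp_all add: Z_def P_def Q_def algebra_simps)
    \<comment> \<open>The top level \<open>k + 2\<close> of the quad is at most
      \<open>2 * m - 1\<close>, hence at most \<open>n + 1\<close>.\<close>
    have kn: "k < n" using k n by simp
    have "cr (z P Q) (z (P + 1) Q) (z (P + 1) (Q + 1)) (z P (Q + 1)) = \<alpha> P / \<beta> Q"
      using integrable kn PQ unfolding integrable_cr_map_def on_levels_def by simp
    then show "cr (Z k p) (Z (Suc k) (p + 1)) (Z (Suc (Suc k)) (p + 1)) (Z (Suc k) p)
        = \<alpha> (p - b) / \<beta> (int k - p + b)"
      unfolding Zs by (simp add: P_def Q_def)
    have "\<exists>!c. cr (rot z (P - Q) (P + Q)) (rot z (P - Q + 1) (P + Q + 1)) c (rot z (P - Q - 1) (P + Q + 1))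
        = \<alpha> ((P - Q + (P + Q)) div 2) / \<beta> ((P + Q - (P - Q)) div 2)"
      using propag[unfolded propagates_def propagation_applicable_def, rule_format, OF kn, of "P - Q"]
      unfolding PQ[symmetric] by simp
    moreover have "rot z (P - Q) (P + Q) = z P Q" "rot z (P - Q + 1) (P + Q + 1) = z (P + 1) Q"
      "rot z (P - Q - 1) (P + Q + 1) = z P (Q + 1)"
      using rot_coords[of z P Q] rot_coords[of z "P + 1" Q] rot_coords[of z P "Q + 1"]
      by (simp_all add: algebra_simps)
    ultimately show "\<exists>!c. cr (Z k p) (Z (Suc k) (p + 1)) c (Z (Suc k) p) = \<alpha> (p - b) / \<beta> (int k - p + b)"
      unfolding Zs P_def[symmetric] Q_def[symmetric] by simp
  qed (use m in auto)
  have row: "recip (Z 1 (int l + 1)) * (\<alpha> (int l - b) - \<beta> (- int l - 1 + b))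
      = row_one_term \<alpha> \<beta> z (int l + (- b))" for l
    unfolding Z1 by (simp add: row_one_term_def algebra_simps)
  have D: "D = (\<Sum>l<m. row_one_term \<alpha> \<beta> z (int l))"
    unfolding D_def row_one_term_def rot1 by simp
  have D': "(\<Sum>l<m. recip (Z 1 (int l + 1)) * (\<alpha> (int l - b) - \<beta> (- int l - 1 + b))) = D"
    unfolding row D by (rule sum_periodic_shift) (rule row_one_term_periodic[OF closed])
  \<comment> \<open>The \<beta>-indices run down from \<open>b - 1\<close>; reflection restores the
    order in \<open>S\<close>.\<close>
  have S': "(\<Sum>l<m. \<alpha> (int l - b) - \<beta> (- int l - 1 + b)) = S"
    using sum_periodic_shift[of \<alpha> m "- b"] sum_periodic_reflect[of \<beta> m "b - 1"] label_per
    by (simp add: S_def sum_subtractf algebra_simps)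
  have "Z (2 * m - 1) (int (2 * m - 1)) = rot z i (2 * int m - 1)"
    unfolding rot_def ib using m by (simp add: Z_def of_nat_diff b_def algebra_simps)
  then have eq: "fst (hom_coord (rot z i (2 * int m - 1))) * D = snd (hom_coord (rot z i (2 * int m - 1))) * S"
    using sphere_top_level_slope unfolding D' S' by simp
  have top: "rot z i (2 * int m - 1) = quot S D" by (rule quot_eqI[OF eq assms(10)])
  moreover have "additive_monodromy m zs k l = D" if "dual_map n \<alpha> \<beta> z zs" "on_levels n k l" for zs k l
    unfolding D by (rule additive_monodromy_eq[OF closed that(1) z_level0 that(2)])
  ultimately show "rot z i (2 * int m - 1) = quot S D \<and>
      (\<forall>zs k l. dual_map n \<alpha> \<beta> z zs \<and> on_levels n k l \<longrightarrow>
        rot z i (2 * int m - 1) = quot S (additive_monodromy m zs k l))"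
    by simp
qed

end
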